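(* Let $\mathbb{P}$ be a semifield and let $(\mathbf{x},\mathbf{y},B,\mathbf{Z})$ be a generalized seed over $\mathbb{P}$, with $d_i=\deg Z_i$ and $D=(d_i\delta_{ij})$, placed at the initial vertex $t_0$ of $\mathbb{T}_n$. Let $c^t_{ij}$, $g^t_{ij}$, $F^t_j(\mathbf{y},\mathbf{z})$ be its $c$-vector entries, $g$-vector entries and $F$-polynomials, and let $B^t=(b^t_{ij})$ be its exchange matrices. Let $F^t_j(\mathbf{y},\boldsymbol{0})$ denote the $F$-polynomial with $z_{i,s}$ set to $0$ for all $1\le i\le n$ and $0<s<d_i$ (while $z_{i,0}=z_{i,d_i}=1$). With $\hat y_k=y_k\prod_{i=1}^n x_i^{b_{ik}}$ define $$x_j^t\big|_{\mathbf{z}=\boldsymbol{0}}=\Big(\prod_{i=1}^n x_i^{g^t_{ij}}\Big)\frac{F^t_j(\hat{\mathbf{y}},\boldsymbol{0})}{F^t_j(\cdot,\boldsymbol{0})\big|_{\mathbb{P}}(\mathbf{y})},\qquad y_j^t\big|_{\mathbf{z}=\boldsymbol{0}}=\Big(\prod_{i=1}^n y_i^{c^t_{ij}}\Big)\prod_{i=1}^n \Big(F^t_i(\cdot,\boldsymbol{0})\big|_{\mathbb{P}}(\mathbf{y})\Big)^{b^t_{ij}},$$ where $F^t_j(\cdot,\boldsymbol{0})$ is regarded as an element of $\mathbb{Q}_{\mathrm{sf}}(y_1,\dots,y_n)$ when it is evaluated in $\mathbb{P}$. Let $({}^R\mathbf{x}^t,{}^R\mathbf{y}^t,{}^RB^t)$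 be the seed at $t\in\mathbb{T}_n$ of the right-companion cluster algebra, i.e. of the ordinary cluster pattern over $\mathbb{P}$ with initial seed $(\mathbf{x},\mathbf{y}^{\mathbf{d}},BD)$ at $t_0$, where $\mathbf{y}^{\mathbf{d}}=(y_1^{d_1},\dots,y_n^{d_n})$. Then for all $t\in\mathbb{T}_n$ and all $1\le i,j\le n$: $$x_i^t\big|_{\mathbf{z}=\boldsymbol{0}}={}^Rx^t_i\qquad\text{and}\qquad \big(y_j^t\big|_{\mathbf{z}=\boldsymbol{0}}\big)^{d_j}={}^Ry^t_j .$$
   Context: Semifields. A semifield is a multiplicative abelian group $\mathbb{P}$ with an associative, commutative operation $\oplus$ over which multiplication distributes. $\mathbb{P}$ is torsion-free, $\mathbb{ZP}$ is its group ring (a domain), $\mathbb{QP}$ its field of fractions. $\mathbb{Q}_{\mathrm{sf}}(u_1,\dots,u_m)$ is the universal semifield of rational functions in $u_1,\dots,u_m$ that can be written in subtraction-free form (usual operations). $\mathrm{Trop}(u_1,\dots,u_m)$ is the free abelian multiplicative group on the $u_j$ with $\prod u_j^{a_j}\oplus\prod u_j^{b_j}=\prod u_j^{\min(a_j,b_j)}$. For $f\in\mathbb{Q}_{\mathrm{sf}}(u_1,\dots,u_m)$ and $p_1,\dots,p_m\in\mathbb{P}$, $f|_{\mathbb{P}}(p_1,\dots,p_m)\in\mathbb{P}$ is the image of $f$ under the semifield homomorphism $\mathbb{Q}_{\mathrm{sf}}(u_1,\dots,u_m)\to\mathbb{P}$ with $u_i\mapsto p_i$, $1\mapsto 1$ (so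 a positive integer $N$ maps to $1\oplus\cdots\oplus1$, $N$ terms). Write $[b]_+=\max(b,0)$. Generalized seeds. A generalized seed $(\mathbf{x},\mathbf{y},B,\mathbf{Z})$ over $\mathbb{P}$ consists of: algebraically independent elements $\mathbf{x}=(x_1,\dots,x_n)$ (cluster variables) of a degree-$n$ purely transcendental extension $\mathcal{F}$ of $\mathbb{QP}$ (identified with $\mathbb{QP}(\mathbf{x})$); $\mathbf{y}=(y_1,\dots,y_n)\in\mathbb{P}^n$ (coefficients); a skew-symmetrizable integer $n\times n$ matrix $B=(b_{ij})$; and polynomials $\mathbf{Z}=(Z_1,\dots,Z_n)$, $Z_i(u)=\sum_{s=0}^{d_i}z_{i,s}u^s$ with $d_i\ge1$, $z_{i,s}\in\mathbb{P}$, $z_{i,0}=z_{i,d_i}=1$. Put $\mathbf{z}=(z_{i,s})$ and $Z_i|_{\mathbb{P}}(y)=\bigoplus_{s=0}^{d_i}z_{i,s}y^s$ for $y\in\mathbb{P}$. Mutation. $\mu_k(\mathbf{x},\mathbf{y},B,\mathbf{Z})=(\mathbf{x}',\mathbf{y}',B',\mathbf{Z}')$, where $x_i'=x_i$ for $i\ne k$ and $x_k'x_k=\big(\prod_i x_i^{[-b_{ik}]_+}\big)^{d_k}\frac{Z_k(\hat y_k)}{Z_k|_{\mathbb{P}}(y_k)}$ with $\hat y_k=y_k\prod_i x_i^{b_{ik}}$; $y_k'=y_k^{-1}$ and $y_j'=y_j(y_k^{d_k})^{[b_{kj}]_+}Z_k|_{\mathbb{P}}(y_k)^{-b_{kj}}$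 for $j\ne k$; $b'_{ij}=-b_{ij}$ if $i=k$ or $j=k$, and $b'_{ij}=b_{ij}+[b_{ik}]_+d_kb_{kj}+b_{ik}d_k[-b_{kj}]_+$ otherwise; $Z_i'=Z_i$ for $i\neq k$ and $Z_k'(u)=u^{d_k}Z_k(u^{-1})$. Patterns. $\mathbb{T}_n$ is the $n$-regular tree with edges labeled by $1,\dots,n$ so that the edges at each vertex have distinct labels. A generalized cluster pattern assigns to each $t\in\mathbb{T}_n$ a generalized seed $(\mathbf{x}^t,\mathbf{y}^t,B^t,\mathbf{Z}^t)$ so that seeds at the ends of an edge labeled $k$ are related by $\mu_k$; it is determined by the seed at the initial vertex $t_0$ (for which the superscript is dropped). An ordinary seed $(\mathbf{x},\mathbf{y},B)$ and its ordinary cluster pattern are the special case $Z_i(u)=1+u$ for all $i$ (so all $d_i=1$). $c$-vectors, $g$-vectors, $F$-polynomials. Regard $x_i$, $y_i$ and $z_{i,s}$ ($0<s<d_i$) as independent indeterminates. $Y$-functions $Y_j^t\in\mathbb{Q}_{\mathrm{sf}}(\mathbf{y},\mathbf{z})$ are the coefficients obtained by performing the $y$-mutations in $\mathbb{P}=\mathbb{Q}_{\mathrm{sf}}(\mathbf{y},\mathbf{z})$. Their images in $\mathrm{Trop}(\mathbf{y},\mathbf{z})$ are monomials $\prod_i y_i^{c^t_{ij}}$; the vectors $\mathbf{c}^t_j=(c^t_{ij})_i$ are the $c$-vectors. $X$-functions $X^t_i\in\mathbb{Q}(\mathbf{x},\mathbf{y},\mathbf{z})$ are the cluster variables obtained by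 taking $\mathbb{P}=\mathrm{Trop}(\mathbf{y},\mathbf{z})$; one has $X_i^t\in\mathbb{Z}[\mathbf{x}^{\pm1},\mathbf{y},\mathbf{z}]$. For the $\mathbb{Z}^n$-grading $\deg x_i=\mathbf{e}_i$, $\deg y_j=-(j\text{-th column of }B)$, $\deg z_{i,s}=0$, each $X_j^t$ is homogeneous, and its degree $\mathbf{g}^t_j=(g^t_{ij})_i$ is the $g$-vector. $F$-polynomials are $F^t_j(\mathbf{y},\mathbf{z})=X^t_j|_{x_1=\cdots=x_n=1}\in\mathbb{Z}[\mathbf{y},\mathbf{z}]$; they admit subtraction-free expressions. *)

theory Defs
  imports
    Complex_Main
    "HOL-Library.Poly_Mapping"
    "HOL-Computational_Algebra.Fraction_Field"
begin

section \<open>Semifields\<close>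

text \<open>The auxiliary addition of a semifield is written \<open>+\<close>. There is no zero, so finite
  sums are not available through \<^const>\<open>sum\<close>.\<close>

class semifield = comm_semiring + comm_monoid_mult + inverse +
  assumes semifield_left_inverse: "inverse a * a = 1"
    and semifield_divide: "a / b = a * inverse b"

fun oplus_upto :: "(nat \<Rightarrow> 'p::semifield) \<Rightarrow> nat \<Rightarrow> 'p" where
  "oplus_upto f 0 = f 0"
| "oplus_upto f (Suc m) = oplus_upto f m + f (Suc m)"

definition semifield_hom :: "('p::semifield \<Rightarrow> 'q::semifield) \<Rightarrow> bool" where
  "semifield_hom h \<longleftrightarrow> (\<forall>a b. h (a + b) = h a + h b) \<and> (\<forall>a b. h (a * b) = h a * h b)"

lemma semifield_right_inverse: "a * inverse a = (1 :: 'p::semifield)"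
  using semifield_left_inverse[of a] by (simp add: mult.commute)

lemma semifield_mult_left_cancel: "(a :: 'p::semifield) * b = a * c \<longleftrightarrow> b = c"
  by (metis mult.assoc mult_1 semifield_left_inverse)

lemma semifield_inverse_unique: "(a :: 'p::semifield) * b = 1 \<Longrightarrow> inverse a = b"
  by (metis semifield_mult_left_cancel semifield_right_inverse)

lemma semifield_inverse_inverse: "inverse (inverse a) = (a :: 'p::semifield)"
  by (rule semifield_inverse_unique) (rule semifield_left_inverse)

lemma semifield_inverse_mult: "inverse (a * b) = inverse a * inverse (b :: 'p::semifield)"
proof (rule semifield_inverse_unique)
  have "a * b * (inverse a * inverse b) = (a * inverse a) * (b * inverse b)"
    by (simp only: ac_simps)
  then show "a * b * (inverse a * inverse b) = 1" by (simp add: semifield_right_inverse)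
qed

lemma semifield_inverse_power: "inverse (a ^ m) = inverse (a :: 'p::semifield) ^ m"
  by (induction m) (auto simp: semifield_inverse_mult intro: semifield_inverse_unique)

lemma semifield_inverse_one: "inverse 1 = (1 :: 'p::semifield)"
  by (rule semifield_inverse_unique) simp

lemma semifield_torsion_free:
  assumes "(a :: 'p::semifield) ^ m = 1" "m > 0"
  shows "a = 1"
proof -
  obtain k where k: "m = Suc k" using assms(2) gr0_implies_Suc by blast
  have shift: "a * oplus_upto (\<lambda>i. a ^ i) j + 1 = oplus_upto (\<lambda>i. a ^ i) j + a ^ Suc j" for j
  proof (induction j)
    case 0 show ?case by (simp add: add.commute)
  next
    case (Suc j)
    have "a * oplus_upto (\<lambda>i. a ^ i) (Suc j) + 1
        = (a * oplus_upto (\<lambda>i. a ^ i) j + 1) + a ^ Suc (Suc j)"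
      by (simp add: distrib_left ac_simps)
    then show ?case using Suc.IH by simp
  qed
  let ?s = "oplus_upto (\<lambda>i. a ^ i) k"
  have split: "?s = (if k = 0 then 1 else oplus_upto (\<lambda>i. a ^ i) (k - 1) + a ^ k)"
    by (cases k) auto
  have "a * ?s = ?s"
  proof (cases k)
    case 0 with assms(1) k show ?thesis by simp
  next
    case (Suc j)
    have "a * ?s = a * oplus_upto (\<lambda>i. a ^ i) j + a ^ Suc k"
      using Suc by (simp add: distrib_left)
    also have "a ^ Suc k = 1" using assms(1) k by simp
    finally show ?thesis using shift[of j] Suc by simp
  qed
  then have "?s * a = ?s * 1" by (simp add: mult.commute)
  then show ?thesis by (simp only: semifield_mult_left_cancel)
qed


section \<open>The group ring of a semifield and its field of fractions\<close>

text \<open>The group ring is a ring of finitely supported functions; \<^type>\<open>poly_mapping\<close> wants its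
  exponents written additively, whence the copy \<open>'p additive\<close> of the group underlying
  the semifield.\<close>

datatype 'p additive = Additive (of_additive: 'p)

instantiation additive :: (semifield) ab_group_add
begin
definition "0 = Additive 1"
definition "a + b = Additive (of_additive a * of_additive b)"
definition "- a = Additive (inverse (of_additive a))"
definition "a - b = Additive (of_additive a * inverse (of_additive b))"
instance
  by standard
    (auto simp: zero_additive_def plus_additive_def uminus_additive_def minus_additive_def
      semifield_left_inverse semifield_right_inverse ac_simps additive.expand)
end

text \<open>A torsion-free abelian group can be linearly ordered (Levi). An arbitrary such order is
  installed on \<open>'p additive\<close>; its only purpose is to make the group ring an integral domain in
  the library's class hierarchy.\<close>

definition cone :: "'p::semifield set \<Rightarrow> bool" where
  "cone C \<longleftrightarrow> 1 \<in> C \<and> (\<forall>a\<in>C. \<forall>b\<in>C. a * b \<in> C) \<and> (\<forall>a. a \<in> C \<longrightarrow> inverse a \<in> C \<longrightarrow> a = 1)"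

lemma cone_power: "cone C \<Longrightarrow> a \<in> C \<Longrightarrow> a ^ m \<in> C"
  by (induction m) (auto simp: cone_def)

lemma cone_extend:
  assumes C: "cone C" and max: "\<And>D. cone D \<Longrightarrow> C \<subseteq> D \<Longrightarrow> D = C" and g: "g \<notin> C"
  shows "\<exists>m>0. inverse (g ^ m) \<in> C"
proof (rule ccontr)
  assume no: "\<not> ?thesis"
  let ?D = "{p * g ^ m | p m. p \<in> C}"
  have "cone ?D"
    unfolding cone_def
  proof (intro conjI ballI allI impI)
    show "1 \<in> ?D" using C by (auto simp: cone_def intro!: exI[of _ 1] exI[of _ "0::nat"])
  next
    fix a b assume "a \<in> ?D" "b \<in> ?D"
    then obtain p m q k where "a = p * g ^ m" "b = q * g ^ k" "p \<in> C" "q \<in> C" by blast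
    moreover have "p * g ^ m * (q * g ^ k) = (p * q) * g ^ (m + k)"
      by (simp add: power_add ac_simps)
    ultimately show "a * b \<in> ?D" using C by (auto simp: cone_def)
  next
    fix a assume "a \<in> ?D" "inverse a \<in> ?D"
    then obtain p m q k where a: "a = p * g ^ m" "p \<in> C" and b: "inverse a = q * g ^ k" "q \<in> C"
      by blast
    have "1 = a * inverse a" by (simp add: semifield_right_inverse)
    also have "\<dots> = g ^ (m + k) * (p * q)" using a b by (simp add: power_add ac_simps)
    finally have "inverse (g ^ (m + k)) = p * q"
      using semifield_inverse_unique[of "g ^ (m + k)" "p * q"] by simp
    moreover have "p * q \<in> C" using C a b by (auto simp: cone_def)
    ultimately have "inverse (g ^ (m + k)) \<in> C" by simp
    with no have mk: "m + k = 0" by (metis neq0_conv)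
    then have "a \<in> C" "inverse a \<in> C" using a b by auto
    with C show "a = 1" by (auto simp: cone_def)
  qed
  moreover have "C \<subseteq> ?D"
  proof
    fix p assume "p \<in> C"
    then show "p \<in> ?D" by (auto intro!: exI[of _ p] exI[of _ "0::nat"])
  qed
  ultimately have "?D = C" by (rule max)
  moreover have "g \<in> ?D" using C by (auto simp: cone_def intro!: exI[of _ 1] exI[of _ "1::nat"])
  ultimately show False using g by simp
qed

lemma exists_total_cone: "\<exists>C :: 'p::semifield set. cone C \<and> (\<forall>a. a \<in> C \<or> inverse a \<in> C)"
proof -
  have "\<exists>M\<in>{C :: 'p set. cone C}. \<forall>X\<in>{C. cone C}. M \<subseteq> X \<longrightarrow> X = M"
  proof (rule subset_Zorn)
    fix K :: "'p set set" assume K: "subset.chain {C. cone C} K"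
    show "\<exists>U\<in>{C. cone C}. \<forall>X\<in>K. X \<subseteq> U"
    proof (cases "K = {}")
      case True
      have "cone {1 :: 'p}" by (auto simp: cone_def)
      with True show ?thesis by auto
    next
      case False
      have cones: "\<And>X. X \<in> K \<Longrightarrow> cone X" and
        chain: "\<And>X Y. X \<in> K \<Longrightarrow> Y \<in> K \<Longrightarrow> X \<subseteq> Y \<or> Y \<subseteq> X"
        using K by (auto simp: subset_chain_def)
      have "cone (\<Union>K)"
        unfolding cone_def
      proof (intro conjI ballI allI impI)
        show "1 \<in> \<Union>K" using False cones by (auto simp: cone_def)
      next
        fix a b assume "a \<in> \<Union>K" "b \<in> \<Union>K"
        then obtain X where "X \<in> K" "a \<in> X" "b \<in> X" using chain by blast
        then show "a * b \<in> \<Union>K" using cones by (auto simp: cone_def)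
      next
        fix a assume "a \<in> \<Union>K" "inverse a \<in> \<Union>K"
        then obtain X where "X \<in> K" "a \<in> X" "inverse a \<in> X" using chain by blast
        then show "a = 1" using cones by (auto simp: cone_def)
      qed
      then show ?thesis by auto
    qed
  qed
  then obtain C :: "'p set" where C: "cone C" and
    max: "\<And>D. cone D \<Longrightarrow> C \<subseteq> D \<Longrightarrow> D = C" by auto
  have "a \<in> C \<or> inverse a \<in> C" for a
  proof (rule ccontr)
    assume n: "\<not> ?thesis"
    obtain m where m: "m > 0" "inverse (a ^ m) \<in> C"
      using cone_extend[OF C max, of a] n by auto
    obtain k where k: "k > 0" "inverse (inverse a ^ k) \<in> C"
      using cone_extend[OF C max, of "inverse a"] n by auto
    have "a ^ k \<in> C"
      using k by (simp add: semifield_inverse_power[symmetric] semifield_inverse_inverse)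
    then have "a ^ (k * m) \<in> C" using cone_power[OF C] by (simp add: power_mult)
    moreover have "inverse (a ^ (k * m)) \<in> C"
      using cone_power[OF C m(2), of k]
      by (simp add: semifield_inverse_power power_mult[symmetric] mult.commute)
    ultimately have "a ^ (k * m) = 1" using C by (auto simp: cone_def)
    then have "a = 1" by (rule semifield_torsion_free) (use k m in simp)
    with n C show False by (auto simp: cone_def)
  qed
  with C show ?thesis by blast
qed

definition total_cone :: "'p::semifield set" where
  "total_cone = (SOME C. cone C \<and> (\<forall>a. a \<in> C \<or> inverse a \<in> C))"

lemma total_cone: "cone (total_cone :: 'p::semifield set)"
  "a \<in> total_cone \<or> inverse a \<in> (total_cone :: 'p::semifield set)"
  using someI_ex[OF exists_total_cone] unfolding total_cone_def by blast+

instantiation additive :: (semifield) "{ordered_cancel_comm_monoid_add, linorder}"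
begin
definition "a \<le> b \<longleftrightarrow> of_additive b * inverse (of_additive a) \<in> total_cone"
definition "a < b \<longleftrightarrow> a \<le> b \<and> a \<noteq> (b :: 'a additive)"
instance
proof
  fix a b c :: "'a additive"
  obtain x y z where xyz: "a = Additive x" "b = Additive y" "c = Additive z"
    by (metis additive.exhaust)
  have inv: "inverse (y * inverse x) = x * inverse y"
    by (simp add: semifield_inverse_mult semifield_inverse_inverse ac_simps)
  show refl: "a \<le> a"
    using total_cone(1)[where 'p = 'a] by (simp add: less_eq_additive_def semifield_right_inverse cone_def)
  show antisym: "a = b" if "a \<le> b" "b \<le> a"
  proof -
    have "y * inverse x = 1"
      using that total_cone(1)[where 'p = 'a] inv xyz by (simp add: less_eq_additive_def cone_def)
    then have "x = y"
      by (metis semifield_inverse_inverse semifield_inverse_unique)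
    then show ?thesis using xyz by simp
  qed
  show "a \<le> c" if "a \<le> b" "b \<le> c"
  proof -
    have "z * inverse y * (y * inverse x) \<in> total_cone"
      using that total_cone(1)[where 'p = 'a] xyz by (auto simp: less_eq_additive_def cone_def)
    moreover have "z * inverse y * (y * inverse x) = z * inverse x * (y * inverse y)"
      by (simp only: ac_simps)
    ultimately show ?thesis using xyz
      by (simp add: less_eq_additive_def semifield_right_inverse)
  qed
  show "a \<le> b \<or> b \<le> a"
    using total_cone(2)[of "y * inverse x"] inv xyz by (auto simp: less_eq_additive_def)
  show "(a < b) = (a \<le> b \<and> \<not> b \<le> a)"
    using refl antisym by (auto simp: less_additive_def)
  show "c + a \<le> c + b" if "a \<le> b"
  proof -
    have "z * y * inverse (z * x) = (z * inverse z) * (y * inverse x)"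
      by (simp add: semifield_inverse_mult ac_simps)
    then show ?thesis using that xyz
      by (simp add: less_eq_additive_def plus_additive_def semifield_right_inverse)
  qed
qed
end

type_synonym 'p group_ring = "'p additive \<Rightarrow>\<^sub>0 int"

type_synonym 'p group_field = "'p group_ring fract"

definition of_semifield :: "'p::semifield \<Rightarrow> 'p group_field" where
  "of_semifield p = Fract (Poly_Mapping.single (Additive p) 1) 1"


section \<open>Polynomials and rational functions in several variables\<close>

text \<open>Indeterminates are wrapped so that they can carry an arbitrary linear order, which makes
  the polynomial ring an integral domain for the library; nothing depends on the order.\<close>

datatype 'v indet = Indet 'v

definition indet_order :: "('v indet \<times> 'v indet) set" where
  "indet_order = (SOME r. well_order_on UNIV r)"

lemma indet_order: "linear_order_on UNIV indet_order"
  using someI_ex[OF well_order_on[of "UNIV :: 'a indet set"]]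
  unfolding indet_order_def well_order_on_def by blast

instantiation indet :: (type) linorder
begin
definition "a \<le> b \<longleftrightarrow> (a, b) \<in> indet_order"
definition "a < b \<longleftrightarrow> a \<le> b \<and> a \<noteq> (b :: 'a indet)"
instance
proof
  fix a b c :: "'a indet"
  have r: "(a, a) \<in> indet_order" and t: "trans (indet_order :: ('a indet \<times> 'a indet) set)"
    and as: "antisym (indet_order :: ('a indet \<times> 'a indet) set)"
    and tot: "a \<noteq> b \<Longrightarrow> (a, b) \<in> indet_order \<or> (b, a) \<in> indet_order"
    using indet_order[where 'a = 'a]
    by (auto simp: linear_order_on_def partial_order_on_def preorder_on_def refl_on_def
        total_on_def)
  show "a \<le> a" using r by (simp add: less_eq_indet_def)
  show "a \<le> b \<Longrightarrow> b \<le> c \<Longrightarrow> a \<le> c" using t by (auto simp: less_eq_indet_def dest: transD)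
  show anti: "a \<le> b \<Longrightarrow> b \<le> a \<Longrightarrow> a = b" using as by (auto simp: less_eq_indet_def dest: antisymD)
  show "a \<le> b \<or> b \<le> a" using r tot by (cases "a = b") (auto simp: less_eq_indet_def)
  show "(a < b) = (a \<le> b \<and> \<not> b \<le> a)"
    using anti r by (auto simp: less_indet_def less_eq_indet_def)
qed
end

type_synonym ('v, 'c) mpoly = "('v indet \<Rightarrow>\<^sub>0 nat) \<Rightarrow>\<^sub>0 'c"

type_synonym 'v ratfun = "('v, int) mpoly fract"

text \<open>Evaluation of a polynomial at \<open>\<sigma>\<close>, coefficients being mapped by \<open>\<phi>\<close>.\<close>

definition mpoly_eval ::
    "('c::zero \<Rightarrow> 'k::comm_semiring_1) \<Rightarrow> ('v \<Rightarrow> 'k) \<Rightarrow> ('v, 'c) mpoly \<Rightarrow> 'k" where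
  "mpoly_eval \<phi> \<sigma> p =
     (\<Sum>m\<in>Poly_Mapping.keys p. \<phi> (Poly_Mapping.lookup p m) *
        (\<Prod>v\<in>Poly_Mapping.keys m. (case v of Indet u \<Rightarrow> \<sigma> u) ^ Poly_Mapping.lookup m v))"

definition ratvar :: "'v \<Rightarrow> 'v ratfun" where
  "ratvar v = Fract (Poly_Mapping.single (Poly_Mapping.single (Indet v) 1) 1) 1"

text \<open>The value of a rational function with rational coefficients under the substitution \<open>\<sigma>\<close>.
  It is meaningful when the function can be written with a denominator that does not vanish
  under \<open>\<sigma>\<close>, and then does not depend on the fraction chosen.\<close>

definition ratfun_eval :: "('v \<Rightarrow> 'k::field) \<Rightarrow> 'v ratfun \<Rightarrow> 'k" where
  "ratfun_eval \<sigma> f = (THE a. \<exists>p q. f = Fract p q \<and> mpoly_eval of_int \<sigma> q \<noteq> 0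
     \<and> a = mpoly_eval of_int \<sigma> p / mpoly_eval of_int \<sigma> q)"


section \<open>The universal semifield\<close>

inductive subtraction_free :: "'v ratfun \<Rightarrow> bool" where
  "subtraction_free 1"
| "subtraction_free (ratvar v)"
| "subtraction_free f \<Longrightarrow> subtraction_free g \<Longrightarrow> subtraction_free (f + g)"
| "subtraction_free f \<Longrightarrow> subtraction_free g \<Longrightarrow> subtraction_free (f * g)"
| "subtraction_free f \<Longrightarrow> subtraction_free g \<Longrightarrow> subtraction_free (f / g)"

definition nonneg_mpoly :: "('v, int) mpoly \<Rightarrow> bool" where
  "nonneg_mpoly p \<longleftrightarrow> p \<noteq> 0 \<and> (\<forall>m. Poly_Mapping.lookup p m \<ge> 0)"

lemma nonneg_mpoly_add: "nonneg_mpoly p \<Longrightarrow> nonneg_mpoly q \<Longrightarrow> nonneg_mpoly (p + q)"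
proof -
  assume a: "nonneg_mpoly p" "nonneg_mpoly q"
  then obtain m where "Poly_Mapping.lookup p m \<noteq> 0"
    unfolding nonneg_mpoly_def by (metis lookup_zero poly_mapping_eqI)
  with a have "Poly_Mapping.lookup p m > 0" "Poly_Mapping.lookup q m \<ge> 0"
    by (auto simp: nonneg_mpoly_def order_less_le)
  then have "Poly_Mapping.lookup (p + q) m > 0"
    by (simp add: lookup_add)
  then have "p + q \<noteq> 0" by auto
  with a show ?thesis by (simp add: nonneg_mpoly_def lookup_add)
qed

lemma nonneg_mpoly_mult: "nonneg_mpoly p \<Longrightarrow> nonneg_mpoly q \<Longrightarrow> nonneg_mpoly (p * q)"
proof -
  assume a: "nonneg_mpoly p" "nonneg_mpoly q"
  have S: "Sum_any f \<ge> 0" if "\<And>x. f x \<ge> 0" for f :: "'b \<Rightarrow> int"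
    using that unfolding Sum_any.expand_set by (simp add: sum_nonneg)
  have "Poly_Mapping.lookup (p * q) m \<ge> 0" for m
    unfolding lookup_mult using a
    by (intro S mult_nonneg_nonneg) (auto simp: nonneg_mpoly_def when_def)
  moreover have "p * q \<noteq> 0" using a by (simp add: nonneg_mpoly_def)
  ultimately show ?thesis by (simp add: nonneg_mpoly_def)
qed

lemma nonneg_mpoly_single: "c > 0 \<Longrightarrow> nonneg_mpoly (Poly_Mapping.single m c)"
  unfolding nonneg_mpoly_def
  by (auto simp: lookup_single when_def poly_mapping_eq_iff fun_eq_iff)

lemma subtraction_free_fract:
  "subtraction_free f \<Longrightarrow> \<exists>p q. nonneg_mpoly p \<and> nonneg_mpoly q \<and> f = Fract p q"
proof (induction rule: subtraction_free.induct)
  case 1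
  have "nonneg_mpoly (1 :: ('a, int) mpoly)"
    using nonneg_mpoly_single[of 1 0] by simp
  then show ?case using One_fract_def by blast
next
  case (2 v)
  have "nonneg_mpoly (1 :: ('a, int) mpoly)"
    using nonneg_mpoly_single[of 1 0] by simp
  then show ?case unfolding ratvar_def using nonneg_mpoly_single[of 1] by (metis zero_less_one)
next
  case (3 f g)
  then obtain p q r s where n: "nonneg_mpoly p" "nonneg_mpoly q" "nonneg_mpoly r" "nonneg_mpoly s"
    and e: "f = Fract p q" "g = Fract r s" by blast
  then have "f + g = Fract (p * s + r * q) (q * s)" by (simp add: nonneg_mpoly_def)
  moreover have "nonneg_mpoly (p * s + r * q)" "nonneg_mpoly (q * s)"
    using n by (simp_all add: nonneg_mpoly_add nonneg_mpoly_mult)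
  ultimately show ?case by blast
next
  case (4 f g)
  then obtain p q r s where n: "nonneg_mpoly p" "nonneg_mpoly q" "nonneg_mpoly r" "nonneg_mpoly s"
    and e: "f = Fract p q" "g = Fract r s" by blast
  then have "f * g = Fract (p * r) (q * s)" by simp
  moreover have "nonneg_mpoly (p * r)" "nonneg_mpoly (q * s)"
    using n by (simp_all add: nonneg_mpoly_mult)
  ultimately show ?case by blast
next
  case (5 f g)
  then obtain p q r s where n: "nonneg_mpoly p" "nonneg_mpoly q" "nonneg_mpoly r" "nonneg_mpoly s"
    and e: "f = Fract p q" "g = Fract r s" by blast
  then have "f / g = Fract (p * s) (q * r)" by simp
  moreover have "nonneg_mpoly (p * s)" "nonneg_mpoly (q * r)"
    using n by (simp_all add: nonneg_mpoly_mult)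
  ultimately show ?case by blast
qed

lemma subtraction_free_nonzero: "subtraction_free f \<Longrightarrow> f \<noteq> 0"
  by (auto dest!: subtraction_free_fract simp: nonneg_mpoly_def Zero_fract_def eq_fract)

typedef 'v qsf = "{f :: 'v ratfun. subtraction_free f}"
  by (auto intro: subtraction_free.intros(1))

setup_lifting type_definition_qsf

instantiation qsf :: (type) semifield
begin
lift_definition one_qsf :: "'a qsf" is 1 by (rule subtraction_free.intros)
lift_definition plus_qsf :: "'a qsf \<Rightarrow> 'a qsf \<Rightarrow> 'a qsf" is "(+)" by (rule subtraction_free.intros)
lift_definition times_qsf :: "'a qsf \<Rightarrow> 'a qsf \<Rightarrow> 'a qsf" is "(*)" by (rule subtraction_free.intros)
lift_definition divide_qsf :: "'a qsf \<Rightarrow> 'a qsf \<Rightarrow> 'a qsf" is "(/)" by (rule subtraction_free.intros)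
lift_definition inverse_qsf :: "'a qsf \<Rightarrow> 'a qsf" is inverse
  by (metis inverse_eq_divide subtraction_free.intros(1,5))
instance
  by standard (transfer; simp add: algebra_simps subtraction_free_nonzero divide_inverse; fail)+
end

lift_definition qsf_var :: "'v \<Rightarrow> 'v qsf" is ratvar by (rule subtraction_free.intros)

text \<open>The value at \<open>p\<close> in a semifield of an element of the universal semifield.\<close>

definition qsf_eval :: "('v \<Rightarrow> 'p::semifield) \<Rightarrow> 'v qsf \<Rightarrow> 'p" where
  "qsf_eval p = (THE h. semifield_hom h \<and> (\<forall>v. h (qsf_var v) = p v))"


section \<open>Tropical semifields\<close>

datatype 'v trop = Trop (trop_exponent: "'v \<Rightarrow>\<^sub>0 int")

lift_definition pointwise_min :: "('v \<Rightarrow>\<^sub>0 int) \<Rightarrow> ('v \<Rightarrow>\<^sub>0 int) \<Rightarrow> 'v \<Rightarrow>\<^sub>0 int"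
  is "\<lambda>a b v. min (a v) (b v)"
proof -
  fix a b :: "'v \<Rightarrow> int"
  assume "finite {v. a v \<noteq> 0}" "finite {v. b v \<noteq> 0}"
  then have "finite ({v. a v \<noteq> 0} \<union> {v. b v \<noteq> 0})" by simp
  then show "finite {v. min (a v) (b v) \<noteq> 0}"
    by (rule rev_finite_subset) (auto simp: min_def)
qed

instantiation trop :: (type) semifield
begin
definition "1 = Trop 0"
definition "a * b = Trop (trop_exponent a + trop_exponent b)"
definition "a + b = Trop (pointwise_min (trop_exponent a) (trop_exponent b))"
definition "inverse a = Trop (- trop_exponent a)"
definition "a div b = Trop (trop_exponent a - trop_exponent b)"
instance
proof
  fix a b c :: "'a trop"
  note defs = one_trop_def times_trop_def plus_trop_def inverse_trop_def divide_trop_def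
  have min: "Poly_Mapping.lookup (pointwise_min p q) v = min (Poly_Mapping.lookup p v) (Poly_Mapping.lookup q v)"
    for p q :: "'a \<Rightarrow>\<^sub>0 int" and v by (simp add: pointwise_min.rep_eq)
  show "a * b * c = a * (b * c)" "a * b = b * a" "1 * a = a" "inverse a * a = 1"
    "a div b = a * inverse b"
    by (simp_all add: defs add.assoc add.commute)
  show "a + b + c = a + (b + c)" "a + b = b + a" "(a + b) * c = a * c + b * c"
    by (auto simp: defs lookup_add min intro!: poly_mapping_eqI)
qed
end

definition trop_var :: "'v \<Rightarrow> 'v trop" where
  "trop_var v = Trop (Poly_Mapping.single v 1)"


section \<open>Generalized seeds and their mutations\<close>

text \<open>The index set \<open>{1,\<dots>,n}\<close> is a finite type \<open>'n\<close>. The exchange polynomial with index \<open>i\<close> has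
  degree \<open>zdeg i\<close> and coefficients \<open>zcoeff i s\<close> for \<open>s \<le> zdeg i\<close>; the values for larger \<open>s\<close> are
  irrelevant. Coefficient mutation does not involve the cluster variables, so these come in a
  record extension.\<close>

record ('n, 'p) yseed =
  coeff :: "'n \<Rightarrow> 'p"
  exch :: "'n \<Rightarrow> 'n \<Rightarrow> int"
  zdeg :: "'n \<Rightarrow> nat"
  zcoeff :: "'n \<Rightarrow> nat \<Rightarrow> 'p"

record ('n, 'p, 'f) seed = "('n, 'p) yseed" +
  cluster :: "'n \<Rightarrow> 'f"

definition pos_part :: "int \<Rightarrow> int" where
  "pos_part b = max b 0"

definition exch_poly_semifield :: "('n, 'p::semifield, 'e) yseed_scheme \<Rightarrow> 'n \<Rightarrow> 'p \<Rightarrow> 'p" where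
  "exch_poly_semifield S k y = oplus_upto (\<lambda>s. zcoeff S k s * y ^ s) (zdeg S k)"

definition mutate_coeff ::
    "'n \<Rightarrow> ('n, 'p::semifield, 'e) yseed_scheme \<Rightarrow> ('n, 'p, 'e) yseed_scheme" where
  "mutate_coeff k S = S \<lparr>
     coeff := (\<lambda>j. if j = k then inverse (coeff S k)
        else coeff S j * (coeff S k ^ zdeg S k) powi pos_part (exch S k j)
          * exch_poly_semifield S k (coeff S k) powi (- exch S k j)),
     exch := (\<lambda>i j. if i = k \<or> j = k then - exch S i j
        else exch S i j + pos_part (exch S i k) * int (zdeg S k) * exch S k j
          + exch S i k * int (zdeg S k) * pos_part (- exch S k j)),
     zcoeff := (\<lambda>i s. if i = k \<and> s \<le> zdeg S k then zcoeff S k (zdeg S k - s) else zcoeff S i s) \<rparr>"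

text \<open>Cluster variables live in a field \<open>'f\<close> into which the coefficient semifield is mapped
  by \<open>\<iota>\<close>.\<close>

definition yhat :: "('p \<Rightarrow> 'f::field) \<Rightarrow> ('n::finite, 'p, 'f) seed \<Rightarrow> 'n \<Rightarrow> 'f" where
  "yhat \<iota> S k = \<iota> (coeff S k) * (\<Prod>i\<in>UNIV. cluster S i powi exch S i k)"

definition exch_poly_field ::
    "('p \<Rightarrow> 'f::field) \<Rightarrow> ('n, 'p, 'f) seed \<Rightarrow> 'n \<Rightarrow> 'f \<Rightarrow> 'f" where
  "exch_poly_field \<iota> S k u = (\<Sum>s\<le>zdeg S k. \<iota> (zcoeff S k s) * u ^ s)"

definition mutate ::
    "('p::semifield \<Rightarrow> 'f::field) \<Rightarrow> 'n::finite \<Rightarrow> ('n, 'p, 'f) seed \<Rightarrow> ('n, 'p, 'f) seed" where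
  "mutate \<iota> k S = (mutate_coeff k S) \<lparr>
     cluster := (\<lambda>i. if i = k
        then (\<Prod>j\<in>UNIV. cluster S j powi pos_part (- exch S j k)) ^ zdeg S k
          * exch_poly_field \<iota> S k (yhat \<iota> S k)
          / \<iota> (exch_poly_semifield S k (coeff S k)) / cluster S k
        else cluster S i) \<rparr>"

definition skew_symmetrizable :: "('n \<Rightarrow> 'n \<Rightarrow> int) \<Rightarrow> bool" where
  "skew_symmetrizable B \<longleftrightarrow> (\<exists>r :: 'n \<Rightarrow> int. (\<forall>i. r i > 0) \<and> (\<forall>i j. r i * B i j = - (r j * B j i)))"

definition field_hom :: "('k::field \<Rightarrow> 'l::field) \<Rightarrow> bool" where
  "field_hom \<phi> \<longleftrightarrow> \<phi> 1 = 1 \<and> (\<forall>a b. \<phi> (a + b) = \<phi> a + \<phi> b) \<and> (\<forall>a b. \<phi> (a * b) = \<phi> a * \<phi> b)"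

definition algebraically_independent :: "('k::field \<Rightarrow> 'l::field) \<Rightarrow> ('n \<Rightarrow> 'l) \<Rightarrow> bool" where
  "algebraically_independent \<phi> x \<longleftrightarrow> (\<forall>p :: ('n, 'k) mpoly. mpoly_eval \<phi> x p = 0 \<longrightarrow> p = 0)"

definition generates_field :: "('k::field \<Rightarrow> 'l::field) \<Rightarrow> ('n \<Rightarrow> 'l) \<Rightarrow> bool" where
  "generates_field \<phi> x \<longleftrightarrow> (\<forall>f. \<exists>p q :: ('n, 'k) mpoly.
     mpoly_eval \<phi> x q \<noteq> 0 \<and> f = mpoly_eval \<phi> x p / mpoly_eval \<phi> x q)"

text \<open>The ambient field \<open>'f\<close> is an extension, via \<open>\<phi>\<close>, of the field of fractions of the group
  ring; it is purely transcendental over it with the cluster as a free generating set.\<close>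

definition generalized_seed ::
    "('p::semifield group_field \<Rightarrow> 'f::field) \<Rightarrow> ('n::finite, 'p, 'f) seed \<Rightarrow> bool" where
  "generalized_seed \<phi> S \<longleftrightarrow>
     field_hom \<phi> \<and> algebraically_independent \<phi> (cluster S) \<and> generates_field \<phi> (cluster S) \<and>
     skew_symmetrizable (exch S) \<and>
     (\<forall>i. zdeg S i \<ge> 1 \<and> zcoeff S i 0 = 1 \<and> zcoeff S i (zdeg S i) = 1)"


section \<open>Patterns\<close>

text \<open>The vertices of the regular tree are represented by the label sequences of the
  non-backtracking paths from the initial vertex \<open>[]\<close>; an edge labeled \<open>k\<close> joins \<open>w\<close> and \<open>w @ [k]\<close>. As mutation in a
  fixed direction is an involution, the seed at a vertex is obtained by mutating along the path.\<close>

definition tree_vertices :: "'n list set" where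
  "tree_vertices = {w. distinct_adj w}"

definition yseed_at ::
    "('n, 'p::semifield) yseed \<Rightarrow> 'n list \<Rightarrow> ('n, 'p) yseed" where
  "yseed_at S t = fold mutate_coeff t S"

definition seed_at ::
    "('p::semifield \<Rightarrow> 'f::field) \<Rightarrow> ('n::finite, 'p, 'f) seed \<Rightarrow> 'n list \<Rightarrow> ('n, 'p, 'f) seed" where
  "seed_at \<iota> S t = fold (mutate \<iota>) t S"

definition ordinary_seed ::
    "('n \<Rightarrow> 'f) \<Rightarrow> ('n \<Rightarrow> 'p::semifield) \<Rightarrow> ('n \<Rightarrow> 'n \<Rightarrow> int) \<Rightarrow> ('n, 'p, 'f) seed" where
  "ordinary_seed x y B =
     \<lparr> coeff = y, exch = B, zdeg = (\<lambda>_. 1), zcoeff = (\<lambda>_ _. 1), cluster = x \<rparr>"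

definition right_companion :: "('n, 'p::semifield, 'f) seed \<Rightarrow> ('n, 'p, 'f) seed" where
  "right_companion S = ordinary_seed (cluster S) (\<lambda>i. coeff S i ^ zdeg S i)
     (\<lambda>i j. exch S i j * int (zdeg S j))"


section \<open>\<open>c\<close>-vectors, \<open>g\<close>-vectors and \<open>F\<close>-polynomials\<close>

text \<open>\<open>Zvar i s\<close> is used only for \<open>0 < s < d i\<close>.\<close>

datatype 'n cvar = Yvar 'n | Zvar 'n nat

datatype 'n xvar = Xvar 'n | Cvar "'n cvar"

definition formal_yseed ::
    "('n cvar \<Rightarrow> 'p::semifield) \<Rightarrow> ('n \<Rightarrow> 'n \<Rightarrow> int) \<Rightarrow> ('n \<Rightarrow> nat) \<Rightarrow> ('n, 'p) yseed" where
  "formal_yseed v B d = \<lparr> coeff = (\<lambda>j. v (Yvar j)), exch = B, zdeg = d,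
     zcoeff = (\<lambda>i s. if 0 < s \<and> s < d i then v (Zvar i s) else 1) \<rparr>"

definition Y_fun :: "('n \<Rightarrow> 'n \<Rightarrow> int) \<Rightarrow> ('n \<Rightarrow> nat) \<Rightarrow> 'n list \<Rightarrow> 'n \<Rightarrow> 'n cvar qsf" where
  "Y_fun B d t j = coeff (yseed_at (formal_yseed qsf_var B d) t) j"

definition c_vec :: "('n \<Rightarrow> 'n \<Rightarrow> int) \<Rightarrow> ('n \<Rightarrow> nat) \<Rightarrow> 'n list \<Rightarrow> 'n \<Rightarrow> 'n \<Rightarrow> int" where
  "c_vec B d t i j =
     Poly_Mapping.lookup (trop_exponent (qsf_eval trop_var (Y_fun B d t j))) (Yvar i)"

text \<open>The fraction field of the group ring of \<open>Trop(y, z)\<close>, with \<open>x\<close> adjoined, is the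
  field \<open>\<rat>(x, y, z)\<close>; under this identification a tropical element is the monomial it
  denotes.\<close>

definition trop_monomial :: "'n cvar trop \<Rightarrow> 'n xvar ratfun" where
  "trop_monomial a =
     (\<Prod>v\<in>Poly_Mapping.keys (trop_exponent a).
        ratvar (Cvar v) powi Poly_Mapping.lookup (trop_exponent a) v)"

definition X_fun ::
    "('n::finite \<Rightarrow> 'n \<Rightarrow> int) \<Rightarrow> ('n \<Rightarrow> nat) \<Rightarrow> 'n list \<Rightarrow> 'n \<Rightarrow> 'n xvar ratfun" where
  "X_fun B d t j = cluster (seed_at trop_monomial
     (yseed.extend (formal_yseed trop_var B d) (seed.fields (\<lambda>i. ratvar (Xvar i)))) t) j"

text \<open>The grading on polynomials, extended to quotients of homogeneous polynomials; on Laurent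
  polynomials in \<open>x\<close> this agrees with the evident grading.\<close>

definition monomial_degree ::
    "('n::finite \<Rightarrow> 'n \<Rightarrow> int) \<Rightarrow> ('n xvar indet \<Rightarrow>\<^sub>0 nat) \<Rightarrow> 'n \<Rightarrow> int" where
  "monomial_degree B m i = int (Poly_Mapping.lookup m (Indet (Xvar i)))
     - (\<Sum>j\<in>UNIV. int (Poly_Mapping.lookup m (Indet (Cvar (Yvar j)))) * B i j)"

definition homogeneous_mpoly ::
    "('n::finite \<Rightarrow> 'n \<Rightarrow> int) \<Rightarrow> ('n xvar, int) mpoly \<Rightarrow> ('n \<Rightarrow> int) \<Rightarrow> bool" where
  "homogeneous_mpoly B p a \<longleftrightarrow> (\<forall>m\<in>Poly_Mapping.keys p. monomial_degree B m = a)"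

definition homogeneous ::
    "('n::finite \<Rightarrow> 'n \<Rightarrow> int) \<Rightarrow> 'n xvar ratfun \<Rightarrow> ('n \<Rightarrow> int) \<Rightarrow> bool" where
  "homogeneous B f g \<longleftrightarrow> (\<exists>p q a b. q \<noteq> 0 \<and> f = Fract p q \<and>
     homogeneous_mpoly B p a \<and> homogeneous_mpoly B q b \<and> g = (\<lambda>i. a i - b i))"

definition g_vec :: "('n::finite \<Rightarrow> 'n \<Rightarrow> int) \<Rightarrow> ('n \<Rightarrow> nat) \<Rightarrow> 'n list \<Rightarrow> 'n \<Rightarrow> 'n \<Rightarrow> int" where
  "g_vec B d t i j = (THE g. homogeneous B (X_fun B d t j) g) i"

text \<open>Since \<open>X_fun\<close> is a Laurent polynomial in \<open>x\<close> with coefficients polynomial in \<open>y, z\<close>, it may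
  be specialized at \<open>x = 1\<close>, and the result, a polynomial, may be specialized at \<open>z = 0\<close>. Both
  specializations are performed in fields of rational functions.\<close>

definition F_poly ::
    "('n::finite \<Rightarrow> 'n \<Rightarrow> int) \<Rightarrow> ('n \<Rightarrow> nat) \<Rightarrow> 'n list \<Rightarrow> 'n \<Rightarrow> 'n cvar ratfun" where
  "F_poly B d t j =
     ratfun_eval (\<lambda>v. case v of Xvar i \<Rightarrow> 1 | Cvar u \<Rightarrow> ratvar u) (X_fun B d t j)"

definition F_poly_z0 ::
    "('n::finite \<Rightarrow> 'n \<Rightarrow> int) \<Rightarrow> ('n \<Rightarrow> nat) \<Rightarrow> 'n list \<Rightarrow> 'n \<Rightarrow> 'n ratfun" where
  "F_poly_z0 B d t j =
     ratfun_eval (\<lambda>u. case u of Yvar i \<Rightarrow> ratvar i | Zvar i s \<Rightarrow> 0) (F_poly B d t j)"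

text \<open>\<open>F_poly_z0\<close> is subtraction-free, hence in the domain on which \<open>Abs_qsf\<close> is meaningful.\<close>

definition F_poly_z0_semifield ::
    "('n::finite \<Rightarrow> 'n \<Rightarrow> int) \<Rightarrow> ('n \<Rightarrow> nat) \<Rightarrow> 'n list \<Rightarrow> 'n \<Rightarrow> ('n \<Rightarrow> 'p::semifield) \<Rightarrow> 'p" where
  "F_poly_z0_semifield B d t j y = qsf_eval y (Abs_qsf (F_poly_z0 B d t j))"


section \<open>Specialization at \<open>z = 0\<close>\<close>

definition cluster_z0 ::
    "('p::semifield \<Rightarrow> 'f::field) \<Rightarrow> ('n::finite, 'p, 'f) seed \<Rightarrow> 'n list \<Rightarrow> 'n \<Rightarrow> 'f" where
  "cluster_z0 \<iota> S t j =
     (\<Prod>i\<in>UNIV. cluster S i powi g_vec (exch S) (zdeg S) t i j)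
     * ratfun_eval (yhat \<iota> S) (F_poly_z0 (exch S) (zdeg S) t j)
     / \<iota> (F_poly_z0_semifield (exch S) (zdeg S) t j (coeff S))"

definition coeff_z0 ::
    "('p::semifield \<Rightarrow> 'f::field) \<Rightarrow> ('n::finite, 'p, 'f) seed \<Rightarrow> 'n list \<Rightarrow> 'n \<Rightarrow> 'p" where
  "coeff_z0 \<iota> S t j =
     (\<Prod>i\<in>UNIV. coeff S i powi c_vec (exch S) (zdeg S) t i j)
     * (\<Prod>i\<in>UNIV. F_poly_z0_semifield (exch S) (zdeg S) t i (coeff S)
          powi exch (seed_at \<iota> S t) i j)"

end

theory Submission
  imports Defs
begin

text \<open>The Laurent phenomenon and sign coherence are not needed. The \<open>X\<close>-functions, the
  \<open>F\<close>-polynomials, their values at \<open>z = 0\<close> in fields and semifields, and the \<open>g\<close>-vectors (written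
  as tropical monomials) all obey one recursion, which uses multiplication and inversion only
  and in which just the exchange polynomial varies; substitutions therefore need to be followed
  through a single step, where subtraction-freeness keeps the denominators from vanishing. At
  \<open>z = 0\<close> the exchange polynomial is \<open>1 + u^d\<close>. Multiplying the recursions for \<open>x^g\<close>,
  \<open>F(yhat, 0)\<close> and \<open>1 / F(y, 0)\<close> cancels their tropical coefficients and leaves the exchange
  relation \<open>(1 + yhat^d) / (1 + y^d)\<close> of the right companion.\<close>

section \<open>Evaluation of polynomials and rational functions\<close>

text \<open>A semifield has no 0, so a seed with \<open>z = 0\<close> is not a seed over it and
  cannot be mutated there; the specialization exists only through the \<open>F\<close>-polynomials.
  The substitutions \<open>x = 1\<close>, \<open>z = 0\<close> and \<open>y = yhat\<close> are in
  turn only partial on fractions. They are therefore handled as relations, each of which also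
  records that the value lies in a set that is closed under sums, products and inverses and omits 0.
  In the ambient field this set consists of quotients of polynomials in the cluster whose
  coefficients are quotients of positive elements of the group ring. The cancellation has one
  source: \<open>y_j\<close> enters the three recursions as \<open>x^(- B_j)\<close> (its degree),
  as \<open>yhat_j\<close> and as \<open>y_j\<close>, and \<open>x^(- B_j) yhat_j / y_j = 1\<close>.
  As \<open>yhat\<close> has degree 0, exchange polynomials contribute nothing to the
  \<open>g\<close>-vectors. Finally \<open>1 + u^d\<close> is the ordinary exchange polynomial at
  \<open>u^d\<close>; this is where the powers of \<open>y\<close> and the columns of
  \<open>B D\<close> come from.\<close>

definition mono_eval :: "('v \<Rightarrow> 'k::comm_semiring_1) \<Rightarrow> ('v indet \<Rightarrow>\<^sub>0 nat) \<Rightarrow> 'k" where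
  "mono_eval \<sigma> m = (\<Prod>v\<in>Poly_Mapping.keys m. (case v of Indet u \<Rightarrow> \<sigma> u) ^ Poly_Mapping.lookup m v)"

lemma mono_eval_superset:
  assumes "finite A" "Poly_Mapping.keys m \<subseteq> A"
  shows "mono_eval \<sigma> m = (\<Prod>v\<in>A. (case v of Indet u \<Rightarrow> \<sigma> u) ^ Poly_Mapping.lookup m v)"
  unfolding mono_eval_def
  by (rule prod.mono_neutral_left) (use assms in \<open>auto simp: in_keys_iff\<close>)

lemma mono_eval_zero [simp]: "mono_eval \<sigma> 0 = 1"
  by (simp add: mono_eval_def)

lemma mono_eval_single [simp]: "mono_eval \<sigma> (Poly_Mapping.single (Indet v) (Suc 0)) = \<sigma> v"
  by (simp add: mono_eval_def)

lemma mono_eval_add: "mono_eval \<sigma> (m + n) = mono_eval \<sigma> m * mono_eval \<sigma> n"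
proof -
  let ?A = "Poly_Mapping.keys m \<union> Poly_Mapping.keys n"
  have "finite ?A" by simp
  moreover have "Poly_Mapping.keys (m + n) \<subseteq> ?A" by (rule Poly_Mapping.keys_add)
  ultimately show ?thesis
    by (simp add: mono_eval_superset[of ?A] lookup_add power_add prod.distrib)
qed

lemma sum_monomials:
  "(\<Sum>m\<in>Poly_Mapping.keys p. Poly_Mapping.single m (Poly_Mapping.lookup p m)) = p"
  by (rule poly_mapping_eqI)
    (auto simp: lookup_sum lookup_single when_def in_keys_iff sum.delta)

definition coeffs_in :: "'c set \<Rightarrow> ('a \<Rightarrow>\<^sub>0 'c::zero) \<Rightarrow> bool" where
  "coeffs_in C p \<longleftrightarrow> (\<forall>m. Poly_Mapping.lookup p m \<in> C)"

lemma coeffs_in_UNIV [simp]: "coeffs_in UNIV p"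
  by (simp add: coeffs_in_def)

locale subsemiring =
  fixes C :: "'c::comm_semiring_0 set"
  assumes zero_in: "0 \<in> C"
    and add_in: "a \<in> C \<Longrightarrow> b \<in> C \<Longrightarrow> a + b \<in> C"
    and mult_in: "a \<in> C \<Longrightarrow> b \<in> C \<Longrightarrow> a * b \<in> C"
begin

lemma coeffs_in_zero: "coeffs_in C 0"
  by (simp add: coeffs_in_def zero_in)

lemma coeffs_in_add: "coeffs_in C p \<Longrightarrow> coeffs_in C q \<Longrightarrow> coeffs_in C (p + q)"
  by (simp add: coeffs_in_def lookup_add add_in)

lemma coeffs_in_single: "c \<in> C \<Longrightarrow> coeffs_in C (Poly_Mapping.single m c)"
  by (simp add: coeffs_in_def lookup_single when_def zero_in)

lemma coeffs_in_sum: "(\<And>i. i \<in> I \<Longrightarrow> coeffs_in C (f i)) \<Longrightarrow> coeffs_in C (\<Sum>i\<in>I. f i)"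
  by (induction I rule: infinite_finite_induct) (auto simp: coeffs_in_zero coeffs_in_add)

lemma product_expand:
  fixes p q :: "'a::comm_monoid_add \<Rightarrow>\<^sub>0 'c"
  shows "p * q = (\<Sum>m\<in>Poly_Mapping.keys p. \<Sum>n\<in>Poly_Mapping.keys q.
    Poly_Mapping.single (m + n) (Poly_Mapping.lookup p m * Poly_Mapping.lookup q n))"
proof -
  have "p * q = (\<Sum>m\<in>Poly_Mapping.keys p. Poly_Mapping.single m (Poly_Mapping.lookup p m)) *
      (\<Sum>n\<in>Poly_Mapping.keys q. Poly_Mapping.single n (Poly_Mapping.lookup q n))"
    by (simp add: sum_monomials)
  then show ?thesis by (simp add: sum_product mult_single)
qed

lemma coeffs_in_mult:
  "coeffs_in C (p :: 'a::comm_monoid_add \<Rightarrow>\<^sub>0 'c) \<Longrightarrow> coeffs_in C q \<Longrightarrow> coeffs_in C (p * q)"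
  unfolding product_expand
  by (intro coeffs_in_sum coeffs_in_single mult_in) (auto simp: coeffs_in_def)

end

text \<open>Evaluation is multiplicative as soon as the coefficient map is so on the coefficients
  that occur. Confining them to \<open>C\<close> covers ring homomorphisms (\<open>C = UNIV\<close>)
  as well as \<open>of_nat (nat c)\<close>, which is a homomorphism on nonnegative integers
  only.\<close>

locale coeff_hom = subsemiring C for C :: "'c::comm_semiring_0 set" +
  fixes \<phi> :: "'c \<Rightarrow> 'k::comm_semiring_1"
  assumes hom_zero: "\<phi> 0 = 0"
    and hom_add: "a \<in> C \<Longrightarrow> b \<in> C \<Longrightarrow> \<phi> (a + b) = \<phi> a + \<phi> b"
    and hom_mult: "a \<in> C \<Longrightarrow> b \<in> C \<Longrightarrow> \<phi> (a * b) = \<phi> a * \<phi> b"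
begin

lemma mpoly_eval_superset:
  assumes "finite A" "Poly_Mapping.keys p \<subseteq> A"
  shows "mpoly_eval \<phi> \<sigma> p = (\<Sum>m\<in>A. \<phi> (Poly_Mapping.lookup p m) * mono_eval \<sigma> m)"
  unfolding mpoly_eval_def mono_eval_def[symmetric]
  by (rule sum.mono_neutral_left) (use assms in \<open>auto simp: in_keys_iff hom_zero\<close>)

lemma mpoly_eval_zero: "mpoly_eval \<phi> \<sigma> 0 = 0"
  by (simp add: mpoly_eval_def)

lemma mpoly_eval_single: "mpoly_eval \<phi> \<sigma> (Poly_Mapping.single m c) = \<phi> c * mono_eval \<sigma> m"
  by (simp add: mpoly_eval_superset[of "{m}"])

lemma mpoly_eval_add:
  assumes "coeffs_in C p" "coeffs_in C q"
  shows "mpoly_eval \<phi> \<sigma> (p + q) = mpoly_eval \<phi> \<sigma> p + mpoly_eval \<phi> \<sigma> q"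
proof -
  let ?A = "Poly_Mapping.keys p \<union> Poly_Mapping.keys q"
  have "finite ?A" by simp
  moreover have "Poly_Mapping.keys (p + q) \<subseteq> ?A" by (rule Poly_Mapping.keys_add)
  ultimately show ?thesis
    using assms
    by (simp add: mpoly_eval_superset[of ?A] lookup_add sum.distrib[symmetric] coeffs_in_def
        hom_add distrib_right)
qed

lemma mpoly_eval_sum:
  "(\<And>i. i \<in> I \<Longrightarrow> coeffs_in C (f i)) \<Longrightarrow>
    mpoly_eval \<phi> \<sigma> (\<Sum>i\<in>I. f i) = (\<Sum>i\<in>I. mpoly_eval \<phi> \<sigma> (f i))"
  by (induction I rule: infinite_finite_induct)
    (auto simp: mpoly_eval_zero mpoly_eval_add coeffs_in_sum)

lemma mpoly_eval_mult:
  assumes "coeffs_in C p" "coeffs_in C q"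
  shows "mpoly_eval \<phi> \<sigma> (p * q) = mpoly_eval \<phi> \<sigma> p * mpoly_eval \<phi> \<sigma> q"
proof -
  have in_C: "Poly_Mapping.lookup p m \<in> C" "Poly_Mapping.lookup q m \<in> C" for m
    using assms by (auto simp: coeffs_in_def)
  have "mpoly_eval \<phi> \<sigma> (p * q) = (\<Sum>m\<in>Poly_Mapping.keys p. \<Sum>n\<in>Poly_Mapping.keys q.
      \<phi> (Poly_Mapping.lookup p m * Poly_Mapping.lookup q n) * mono_eval \<sigma> (m + n))"
    unfolding product_expand
    by (simp add: mpoly_eval_sum mpoly_eval_single coeffs_in_sum coeffs_in_single mult_in in_C)
  also have "\<dots> = (\<Sum>m\<in>Poly_Mapping.keys p. \<phi> (Poly_Mapping.lookup p m) * mono_eval \<sigma> m) *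
      (\<Sum>n\<in>Poly_Mapping.keys q. \<phi> (Poly_Mapping.lookup q n) * mono_eval \<sigma> n)"
    by (simp add: sum_product mono_eval_add hom_mult in_C ac_simps)
  also have "\<dots> = mpoly_eval \<phi> \<sigma> p * mpoly_eval \<phi> \<sigma> q"
    by (simp only: mpoly_eval_def mono_eval_def)
  finally show ?thesis .
qed

end

interpretation int_eval: coeff_hom UNIV "of_int :: int \<Rightarrow> 'k::comm_ring_1"
  by unfold_locales auto

text \<open>The graph of the partial ring homomorphism that substitutes \<open>\<sigma>\<close>.\<close>

definition evaluates :: "('v \<Rightarrow> 'k::field) \<Rightarrow> 'v ratfun \<Rightarrow> 'k \<Rightarrow> bool" where
  "evaluates \<sigma> f a \<longleftrightarrow> (\<exists>p q. f = Fract p q \<and> mpoly_eval of_int \<sigma> q \<noteq> 0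
     \<and> a = mpoly_eval of_int \<sigma> p / mpoly_eval of_int \<sigma> q)"

lemma mpoly_eval_nonzero: "mpoly_eval of_int \<sigma> q \<noteq> (0 :: 'k::field) \<Longrightarrow> q \<noteq> 0"
  by (auto simp: int_eval.mpoly_eval_zero)

lemma evaluates_unique: "evaluates \<sigma> f a \<Longrightarrow> evaluates \<sigma> f b \<Longrightarrow> a = b"
proof -
  assume "evaluates \<sigma> f a" "evaluates \<sigma> f b"
  then obtain p q p' q' where
    f: "f = Fract p q" "f = Fract p' q'"
    and nz: "mpoly_eval of_int \<sigma> q \<noteq> 0" "mpoly_eval of_int \<sigma> q' \<noteq> 0"
    and ab: "a = mpoly_eval of_int \<sigma> p / mpoly_eval of_int \<sigma> q"
      "b = mpoly_eval of_int \<sigma> p' / mpoly_eval of_int \<sigma> q'"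
    unfolding evaluates_def by blast
  have "p * q' = p' * q"
    using f nz by (metis eq_fract(1) mpoly_eval_nonzero)
  then have "mpoly_eval of_int \<sigma> p * mpoly_eval of_int \<sigma> q'
      = mpoly_eval of_int \<sigma> p' * mpoly_eval of_int \<sigma> q"
    by (metis int_eval.mpoly_eval_mult coeffs_in_UNIV)
  then show "a = b" using nz ab by (simp add: frac_eq_eq)
qed

lemma ratfun_eval_eq: "evaluates \<sigma> f a \<Longrightarrow> ratfun_eval \<sigma> f = a"
  unfolding ratfun_eval_def evaluates_def[symmetric]
  by (blast intro: the_equality evaluates_unique)

lemma evaluates_zero: "evaluates \<sigma> 0 0"
  unfolding evaluates_def Zero_fract_def
  by (rule exI[of _ 0], rule exI[of _ 1])
    (simp add: int_eval.mpoly_eval_zero single_one[symmetric] int_eval.mpoly_eval_single del: single_one)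

lemma evaluates_one: "evaluates \<sigma> 1 1"
  unfolding evaluates_def One_fract_def
  by (rule exI[of _ 1], rule exI[of _ 1])
    (simp add: single_one[symmetric] int_eval.mpoly_eval_single del: single_one)

lemma evaluates_ratvar: "evaluates \<sigma> (ratvar v) (\<sigma> v)"
  unfolding evaluates_def ratvar_def
  by (intro exI conjI, rule refl)
    (simp_all add: single_one[symmetric] int_eval.mpoly_eval_single del: single_one)

lemma evaluates_add:
  assumes "evaluates \<sigma> f a" "evaluates \<sigma> g b"
  shows "evaluates \<sigma> (f + g) (a + b)"
proof -
  obtain p q p' q' where
    f: "f = Fract p q" "g = Fract p' q'"
    and nz: "mpoly_eval of_int \<sigma> q \<noteq> 0" "mpoly_eval of_int \<sigma> q' \<noteq> 0"
    and ab: "a = mpoly_eval of_int \<sigma> p / mpoly_eval of_int \<sigma> q"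
      "b = mpoly_eval of_int \<sigma> p' / mpoly_eval of_int \<sigma> q'"
    using assms unfolding evaluates_def by blast
  show ?thesis
    unfolding evaluates_def
    by (rule exI[of _ "p * q' + p' * q"], rule exI[of _ "q * q'"])
      (use nz in \<open>simp add: f ab mpoly_eval_nonzero add_frac_eq int_eval.mpoly_eval_mult
        int_eval.mpoly_eval_add\<close>)
qed

lemma evaluates_mult:
  assumes "evaluates \<sigma> f a" "evaluates \<sigma> g b"
  shows "evaluates \<sigma> (f * g) (a * b)"
proof -
  obtain p q p' q' where
    f: "f = Fract p q" "g = Fract p' q'"
    and nz: "mpoly_eval of_int \<sigma> q \<noteq> 0" "mpoly_eval of_int \<sigma> q' \<noteq> 0"
    and ab: "a = mpoly_eval of_int \<sigma> p / mpoly_eval of_int \<sigma> q"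
      "b = mpoly_eval of_int \<sigma> p' / mpoly_eval of_int \<sigma> q'"
    using assms unfolding evaluates_def by blast
  show ?thesis
    unfolding evaluates_def
    by (rule exI[of _ "p * p'"], rule exI[of _ "q * q'"])
      (use nz in \<open>simp add: f ab int_eval.mpoly_eval_mult\<close>)
qed

text \<open>The only operation that can leave the domain of a substitution; the positive sets
  introduced for the \<open>F\<close>-polynomials serve to guarantee
  \<open>a \<noteq> 0\<close>.\<close>

lemma evaluates_inverse:
  assumes "evaluates \<sigma> f a" "a \<noteq> 0"
  shows "evaluates \<sigma> (inverse f) (inverse a)"
proof -
  obtain p q where
    f: "f = Fract p q" "a = mpoly_eval of_int \<sigma> p / mpoly_eval of_int \<sigma> q"
    and nz: "mpoly_eval of_int \<sigma> q \<noteq> 0"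
    using assms unfolding evaluates_def by blast
  show ?thesis
    unfolding evaluates_def
    by (rule exI[of _ q], rule exI[of _ p]) (use nz assms(2) in \<open>auto simp: f\<close>)
qed

lemma evaluates_power: "evaluates \<sigma> f a \<Longrightarrow> evaluates \<sigma> (f ^ m) (a ^ m)"
  by (induction m) (auto intro: evaluates_one evaluates_mult)

lemma evaluates_sum:
  "(\<And>i. i \<in> I \<Longrightarrow> evaluates \<sigma> (f i) (a i)) \<Longrightarrow> evaluates \<sigma> (\<Sum>i\<in>I. f i) (\<Sum>i\<in>I. a i)"
  by (induction I rule: infinite_finite_induct) (auto intro: evaluates_zero evaluates_add)

section \<open>The universal property of subtraction-free rational functions\<close>

text \<open>\<open>mpoly_eval\<close> needs a zero, which a semifield does not have. A formal one is
  adjoined, neutral for addition and absorbing for multiplication, so that polynomials with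
  nonnegative coefficients can be evaluated.\<close>

datatype 'p adjoin_zero = Zero | Adj 'p

instantiation adjoin_zero :: (semifield) comm_semiring_1
begin
definition "0 = Zero"
definition "1 = Adj 1"
fun plus_adjoin_zero :: "'a adjoin_zero \<Rightarrow> 'a adjoin_zero \<Rightarrow> 'a adjoin_zero" where
  "plus_adjoin_zero Zero b = b"
| "plus_adjoin_zero a Zero = a"
| "plus_adjoin_zero (Adj a) (Adj b) = Adj (a + b)"
fun times_adjoin_zero :: "'a adjoin_zero \<Rightarrow> 'a adjoin_zero \<Rightarrow> 'a adjoin_zero" where
  "times_adjoin_zero (Adj a) (Adj b) = Adj (a * b)"
| "times_adjoin_zero a b = Zero"
instance
proof
  fix a b c :: "'a adjoin_zero"
  show "a + b + c = a + (b + c)" by (cases a; cases b; cases c) (simp_all add: add.assoc)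
  show "a + b = b + a" by (cases a; cases b) (simp_all add: add.commute)
  show "a * b * c = a * (b * c)" by (cases a; cases b; cases c) (simp_all add: mult.assoc)
  show "a * b = b * a" by (cases a; cases b) (simp_all add: mult.commute)
  show "(a + b) * c = a * c + b * c" by (cases a; cases b; cases c) (simp_all add: distrib_right)
  show "0 + a = a" by (simp add: zero_adjoin_zero_def)
  show "0 * a = 0" by (simp add: zero_adjoin_zero_def)
  show "a * 0 = 0" by (cases a) (simp_all add: zero_adjoin_zero_def)
  show "1 * a = a" by (cases a) (simp_all add: one_adjoin_zero_def)
  show "(0 :: 'a adjoin_zero) \<noteq> 1"
    by (simp add: zero_adjoin_zero_def one_adjoin_zero_def)
qed
end

lemma adjoin_zero_add_eq_0: "a + b = (0 :: 'p::semifield adjoin_zero) \<longleftrightarrow> a = 0 \<and> b = 0"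
  by (cases a; cases b) (auto simp: zero_adjoin_zero_def)

lemma adjoin_zero_mult_eq_0: "a * b = (0 :: 'p::semifield adjoin_zero) \<longleftrightarrow> a = 0 \<or> b = 0"
  by (cases a; cases b) (auto simp: zero_adjoin_zero_def)

lemma adjoin_zero_sum_eq_0:
  "finite I \<Longrightarrow> (\<Sum>i\<in>I. f i) = (0 :: 'p::semifield adjoin_zero) \<longleftrightarrow> (\<forall>i\<in>I. f i = 0)"
  by (induction I rule: finite_induct) (auto simp: adjoin_zero_add_eq_0)

lemma adjoin_zero_of_nat_eq_0: "of_nat m = (0 :: 'p::semifield adjoin_zero) \<longleftrightarrow> m = 0"
  by (induction m) (auto simp: adjoin_zero_add_eq_0)

lemma adjoin_zero_power_Adj_neq_0: "Adj a ^ m \<noteq> (0 :: 'p::semifield adjoin_zero)"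
proof (induction m)
  case (Suc m)
  have "Adj a \<noteq> 0" by (simp add: zero_adjoin_zero_def)
  with Suc show ?case by (simp add: adjoin_zero_mult_eq_0)
qed simp

lemma adjoin_zero_prod_neq_0:
  "(\<And>i. i \<in> I \<Longrightarrow> f i \<noteq> 0) \<Longrightarrow> (\<Prod>i\<in>I. f i) \<noteq> (0 :: 'p::semifield adjoin_zero)"
  by (induction I rule: infinite_finite_induct) (auto simp: adjoin_zero_mult_eq_0)

interpretation nonneg_eval:
  coeff_hom "{0..}" "\<lambda>c. of_nat (nat c) :: 'p::semifield adjoin_zero"
  by unfold_locales (auto simp: nat_add_distrib nat_mult_distrib)

definition nonneg_value :: "('v \<Rightarrow> 'p::semifield) \<Rightarrow> ('v, int) mpoly \<Rightarrow> 'p adjoin_zero" where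
  "nonneg_value \<sigma> = mpoly_eval (\<lambda>c. of_nat (nat c)) (\<lambda>v. Adj (\<sigma> v))"

lemma nonneg_coeffs: "nonneg_mpoly p \<Longrightarrow> coeffs_in {0..} p"
  by (simp add: nonneg_mpoly_def coeffs_in_def)

text \<open>No cancellation is possible: a sum vanishes only if every term does, and the term of any
  one monomial of \<open>p\<close> is nonzero.\<close>

lemma nonneg_value_Adj:
  assumes "nonneg_mpoly p"
  obtains a where "nonneg_value \<sigma> p = Adj a"
proof -
  from assms obtain m where m: "m \<in> Poly_Mapping.keys p"
    unfolding nonneg_mpoly_def by (metis keys_eq_empty ex_in_conv)
  with assms have "nat (Poly_Mapping.lookup p m) \<noteq> 0"
    unfolding nonneg_mpoly_def by (metis in_keys_iff int_nat_eq of_nat_0)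
  moreover have "mono_eval (\<lambda>v. Adj (\<sigma> v)) m \<noteq> 0"
    unfolding mono_eval_def
    by (intro adjoin_zero_prod_neq_0)
      (metis (no_types, lifting) adjoin_zero_power_Adj_neq_0 indet.case indet.exhaust)
  ultimately have "nonneg_value \<sigma> p \<noteq> 0"
    using m unfolding nonneg_value_def mpoly_eval_def mono_eval_def[symmetric]
    by (auto simp: adjoin_zero_sum_eq_0 adjoin_zero_mult_eq_0 adjoin_zero_of_nat_eq_0)
  then show ?thesis using that by (cases "nonneg_value \<sigma> p") (auto simp: zero_adjoin_zero_def)
qed

definition semifield_evaluates :: "('v \<Rightarrow> 'p::semifield) \<Rightarrow> 'v qsf \<Rightarrow> 'p \<Rightarrow> bool" where
  "semifield_evaluates \<sigma> f a \<longleftrightarrow> (\<exists>p q u v. nonneg_mpoly p \<and> nonneg_mpoly q \<and>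
     Rep_qsf f = Fract p q \<and> nonneg_value \<sigma> p = Adj u \<and> nonneg_value \<sigma> q = Adj v \<and>
     a = u * inverse v)"

lemma semifield_evaluates_total: "\<exists>a. semifield_evaluates \<sigma> f a"
proof -
  obtain p q where "nonneg_mpoly p" "nonneg_mpoly q" "Rep_qsf f = Fract p q"
    using subtraction_free_fract[of "Rep_qsf f"] Rep_qsf[of f] by auto
  then show ?thesis
    unfolding semifield_evaluates_def by (metis nonneg_value_Adj)
qed

lemma semifield_cross_mult:
  "a * inverse b = c * inverse d \<longleftrightarrow> a * d = c * (b :: 'p::semifield)"
proof -
  have "a * inverse b * (b * d) = a * d" "c * inverse d * (b * d) = c * b"
    by (metis mult.assoc mult.commute mult_1_right semifield_left_inverse)+
  then show ?thesis by (metis mult.commute semifield_mult_left_cancel)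
qed

lemma semifield_evaluates_unique:
  assumes "semifield_evaluates \<sigma> f a" "semifield_evaluates \<sigma> f b"
  shows "a = b"
proof -
  obtain p q u v p' q' u' v' where nn: "nonneg_mpoly p" "nonneg_mpoly q"
      "nonneg_mpoly p'" "nonneg_mpoly q'"
    and f: "Fract p q = Fract p' q'"
    and val: "nonneg_value \<sigma> p = Adj u" "nonneg_value \<sigma> q = Adj v"
      "nonneg_value \<sigma> p' = Adj u'" "nonneg_value \<sigma> q' = Adj v'"
    and ab: "a = u * inverse v" "b = u' * inverse v'"
    using assms unfolding semifield_evaluates_def by metis
  have "p * q' = p' * q"
    using f nn by (simp add: eq_fract nonneg_mpoly_def)
  then have "nonneg_value \<sigma> p * nonneg_value \<sigma> q' = nonneg_value \<sigma> p' * nonneg_value \<sigma> q"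
    unfolding nonneg_value_def
    by (metis nn nonneg_coeffs nonneg_eval.mpoly_eval_mult)
  then show ?thesis by (simp add: val ab semifield_cross_mult)
qed

lemma semifield_evaluates_var:
  fixes \<sigma> :: "'v \<Rightarrow> 'p::semifield"
  shows "semifield_evaluates \<sigma> (qsf_var v) (\<sigma> v)"
proof -
  have "nonneg_mpoly (1 :: ('v, int) mpoly)"
    using nonneg_mpoly_single[of 1 0] by simp
  moreover have "nonneg_value \<sigma> (1 :: ('v, int) mpoly) = Adj 1"
    unfolding nonneg_value_def single_one[symmetric] nonneg_eval.mpoly_eval_single
    by (simp add: one_adjoin_zero_def)
  moreover have "nonneg_value \<sigma> (Poly_Mapping.single (Poly_Mapping.single (Indet v) 1) 1) = Adj (\<sigma> v)"
    by (simp add: nonneg_value_def nonneg_eval.mpoly_eval_single)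
  moreover have "nonneg_mpoly (Poly_Mapping.single (Poly_Mapping.single (Indet v) (1::nat)) (1::int))"
    by (simp add: nonneg_mpoly_single)
  ultimately show ?thesis
    unfolding semifield_evaluates_def qsf_var.rep_eq ratvar_def
    by (metis mult_1_right semifield_inverse_one)
qed

lemma semifield_evaluates_mult:
  assumes "semifield_evaluates \<sigma> f a" "semifield_evaluates \<sigma> g b"
  shows "semifield_evaluates \<sigma> (f * g) (a * b)"
proof -
  obtain p q u v p' q' u' v' where nn: "nonneg_mpoly p" "nonneg_mpoly q"
      "nonneg_mpoly p'" "nonneg_mpoly q'"
    and f: "Rep_qsf f = Fract p q" "Rep_qsf g = Fract p' q'"
    and val: "nonneg_value \<sigma> p = Adj u" "nonneg_value \<sigma> q = Adj v"
      "nonneg_value \<sigma> p' = Adj u'" "nonneg_value \<sigma> q' = Adj v'"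
    and ab: "a = u * inverse v" "b = u' * inverse v'"
    using assms unfolding semifield_evaluates_def by metis
  have "nonneg_value \<sigma> (p * p') = Adj (u * u')" "nonneg_value \<sigma> (q * q') = Adj (v * v')"
    using nn val by (simp_all add: nonneg_value_def nonneg_eval.mpoly_eval_mult nonneg_coeffs)
  moreover have "Rep_qsf (f * g) = Fract (p * p') (q * q')"
    by (simp add: times_qsf.rep_eq f)
  moreover have "a * b = (u * u') * inverse (v * v')"
    by (simp add: ab semifield_inverse_mult ac_simps)
  ultimately show ?thesis
    unfolding semifield_evaluates_def using nn by (meson nonneg_mpoly_mult)
qed

lemma semifield_evaluates_add:
  assumes "semifield_evaluates \<sigma> f a" "semifield_evaluates \<sigma> g b"
  shows "semifield_evaluates \<sigma> (f + g) (a + b)"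
proof -
  obtain p q u v p' q' u' v' where nn: "nonneg_mpoly p" "nonneg_mpoly q"
      "nonneg_mpoly p'" "nonneg_mpoly q'"
    and f: "Rep_qsf f = Fract p q" "Rep_qsf g = Fract p' q'"
    and val: "nonneg_value \<sigma> p = Adj u" "nonneg_value \<sigma> q = Adj v"
      "nonneg_value \<sigma> p' = Adj u'" "nonneg_value \<sigma> q' = Adj v'"
    and ab: "a = u * inverse v" "b = u' * inverse v'"
    using assms unfolding semifield_evaluates_def by metis
  have "nonneg_value \<sigma> (p * q' + p' * q) = Adj (u * v' + u' * v)"
    "nonneg_value \<sigma> (q * q') = Adj (v * v')"
    using nn val
    by (simp_all add: nonneg_value_def nonneg_eval.mpoly_eval_mult nonneg_eval.mpoly_eval_add
        nonneg_coeffs nonneg_eval.coeffs_in_mult)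
  moreover have "Rep_qsf (f + g) = Fract (p * q' + p' * q) (q * q')"
    using nn by (simp add: plus_qsf.rep_eq f nonneg_mpoly_def)
  moreover have "a + b = (u * v' + u' * v) * inverse (v * v')"
  proof -
    have "(u * v' + u' * v) * inverse (v * v')
        = u * inverse v * (v' * inverse v') + u' * inverse v' * (v * inverse v)"
      by (simp only: semifield_inverse_mult distrib_right) (simp only: ac_simps)
    then show ?thesis by (simp add: ab semifield_right_inverse)
  qed
  moreover have "nonneg_mpoly (p * q' + p' * q)" "nonneg_mpoly (q * q')"
    using nn by (simp_all add: nonneg_mpoly_add nonneg_mpoly_mult)
  ultimately show ?thesis
    unfolding semifield_evaluates_def by blast
qed

section \<open>Uniqueness and existence of evaluation homomorphisms\<close>

lemma semifield_idem: "a * a = (a :: 'p::semifield) \<Longrightarrow> a = 1"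
  by (metis mult_1_right semifield_mult_left_cancel)

lemma semifield_hom_one: "semifield_hom h \<Longrightarrow> h 1 = 1"
  unfolding semifield_hom_def by (metis mult_1_right semifield_idem)

lemma semifield_hom_mult: "semifield_hom h \<Longrightarrow> h (a * b) = h a * h b"
  by (simp add: semifield_hom_def)

lemma semifield_hom_add: "semifield_hom h \<Longrightarrow> h (a + b) = h a + h b"
  by (simp add: semifield_hom_def)

lemma semifield_hom_inverse: "semifield_hom h \<Longrightarrow> h (inverse a) = inverse (h a)"
  by (metis semifield_hom_mult semifield_hom_one semifield_inverse_unique semifield_right_inverse)

lemma semifield_hom_unique:
  assumes "semifield_hom g" "semifield_hom h" "\<And>v. g (qsf_var v) = h (qsf_var v)"
  shows "g = h"
proof
  have "g (Abs_qsf f) = h (Abs_qsf f)" if "subtraction_free f" for f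
    using that
  proof (induction rule: subtraction_free.induct)
    case 1
    then show ?case using assms by (metis one_qsf_def semifield_hom_one)
  next
    case (2 v)
    then show ?case using assms(3)[of v] by (simp add: qsf_var_def)
  next
    case (3 f f')
    then have "Abs_qsf (f + f') = Abs_qsf f + Abs_qsf f'"
      by (simp add: plus_qsf.abs_eq eq_onp_same_args)
    with 3 assms show ?case by (simp add: semifield_hom_add)
  next
    case (4 f f')
    then have "Abs_qsf (f * f') = Abs_qsf f * Abs_qsf f'"
      by (simp add: times_qsf.abs_eq eq_onp_same_args)
    with 4 assms show ?case by (simp add: semifield_hom_mult)
  next
    case (5 f f')
    then have "Abs_qsf (f / f') = Abs_qsf f / Abs_qsf f'"
      by (simp add: divide_qsf.abs_eq eq_onp_same_args)
    with 5 assms show ?case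
      by (simp add: semifield_divide semifield_hom_mult semifield_hom_inverse)
  qed
  then show "g f = h f" for f by (metis Rep_qsf Rep_qsf_inverse mem_Collect_eq)
qed

text \<open>Gives meaning to the definite description in \<open>qsf_eval\<close>: the graph
  \<open>semifield_evaluates\<close> provides a homomorphism, and a homomorphism is determined by
  its values on the variables because these generate all subtraction-free functions.\<close>

lemma qsf_eval_hom_var: "semifield_hom (qsf_eval \<sigma>) \<and> (\<forall>v. qsf_eval \<sigma> (qsf_var v) = \<sigma> v)"
  unfolding qsf_eval_def
proof (rule theI[of _ "\<lambda>f. THE a. semifield_evaluates \<sigma> f a"])
  let ?h = "\<lambda>f. THE a. semifield_evaluates \<sigma> f a"
  have h: "?h f = a" if "semifield_evaluates \<sigma> f a" for f a
    using that by (blast intro: the_equality semifield_evaluates_unique)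
  have ev: "semifield_evaluates \<sigma> f (?h f)" for f
    using semifield_evaluates_total h by metis
  show "semifield_hom ?h \<and> (\<forall>v. ?h (qsf_var v) = \<sigma> v)"
    unfolding semifield_hom_def
    by (auto intro!: h semifield_evaluates_add semifield_evaluates_mult semifield_evaluates_var ev)
  show "g = ?h" if "semifield_hom g \<and> (\<forall>v. g (qsf_var v) = \<sigma> v)" for g
    using that \<open>semifield_hom ?h \<and> (\<forall>v. ?h (qsf_var v) = \<sigma> v)\<close>
    by (intro semifield_hom_unique) auto
qed

section \<open>Integer powers in a semifield\<close>

lemma semifield_powi_plus_one: "(a :: 'p::semifield) powi (n + 1) = a powi n * a"
proof (cases "n \<ge> 0")
  case True
  then show ?thesis by (simp add: power_int_def nat_add_distrib mult.commute)
next
  case False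
  \<comment> \<open>Negative exponents are written with a shift by one so that one factor
    \<open>inverse a\<close> can be split off.\<close>
  then obtain k where n: "n = - 1 - int k"
    by (metis add_diff_cancel_left' diff_minus_eq_add int_one_le_iff_zero_less linorder_not_le
        minus_diff_eq neg_0_less_iff_less nonneg_eq_int uminus_add_conv_diff zle_iff_zadd)
  have "inverse a * inverse a ^ k * a = inverse a ^ k"
    by (metis mult.assoc mult.commute mult_1_right semifield_left_inverse)
  moreover have "nat (1 + int k) = Suc k" by simp
  ultimately show ?thesis by (simp add: n power_int_def nat_add_distrib)
qed

lemma semifield_powi_zero [simp]: "(a :: 'p::semifield) powi 0 = 1"
  by (simp add: power_int_def)

lemma semifield_powi_minus_one: "(a :: 'p::semifield) powi (n - 1) = a powi n * inverse a"
proof -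
  have "a powi n = a powi (n - 1) * a"
    using semifield_powi_plus_one[of a "n - 1"] by simp
  then show ?thesis by (metis mult.assoc mult_1_right semifield_right_inverse)
qed

lemma semifield_powi_add: "(a :: 'p::semifield) powi (m + n) = a powi m * a powi n"
proof (induction n rule: int_induct[where k = 0])
  case base
  show ?case by simp
next
  case (step1 i)
  have "m + (i + 1) = m + i + 1" by simp
  with step1 show ?case by (simp only: semifield_powi_plus_one mult.assoc)
next
  case (step2 i)
  have "m + (i - 1) = m + i - 1" by simp
  with step2 show ?case by (simp only: semifield_powi_minus_one mult.assoc)
qed

lemma semifield_one_powi [simp]: "1 powi n = (1 :: 'p::semifield)"
  by (simp add: power_int_def semifield_inverse_one)

lemma semifield_powi_mult_distrib: "((a :: 'p::semifield) * b) powi n = a powi n * b powi n"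
  by (simp add: power_int_def power_mult_distrib semifield_inverse_mult)

lemma semifield_powi_minus: "(a :: 'p::semifield) powi (- n) = inverse (a powi n)"
  by (rule semifield_inverse_unique[symmetric]) (simp add: semifield_powi_add[symmetric])

lemma semifield_inverse_powi: "inverse (a :: 'p::semifield) powi n = inverse (a powi n)"
  by (rule semifield_inverse_unique[symmetric])
    (simp add: semifield_powi_mult_distrib[symmetric] semifield_right_inverse)

lemma semifield_powi_mult: "(a :: 'p::semifield) powi (m * n) = (a powi m) powi n"
proof (induction n rule: int_induct[where k = 0])
  case base
  show ?case by simp
next
  case (step1 i)
  then show ?case by (simp add: distrib_left semifield_powi_add semifield_powi_plus_one)
next
  case (step2 i)
  have "m * (i - 1) = m * i + - m" by (simp add: algebra_simps)
  then show ?case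
    by (simp only: semifield_powi_add semifield_powi_minus semifield_powi_minus_one step2)
qed

lemma semifield_power_eq_powi: "(a :: 'p::semifield) ^ m = a powi int m"
  by (simp add: power_int_def)

lemma semifield_powi_prod: "(\<Prod>i\<in>I. f i :: 'p::semifield) powi n = (\<Prod>i\<in>I. f i powi n)"
  by (induction I rule: infinite_finite_induct) (auto simp: semifield_powi_mult_distrib)

lemma semifield_prod_powi_minus:
  "(\<Prod>i\<in>I. f i powi (- e i)) = inverse (\<Prod>i\<in>I. f i powi e i :: 'p::semifield)"
  by (induction I rule: infinite_finite_induct)
    (auto simp: semifield_inverse_one semifield_powi_minus semifield_inverse_mult)

section \<open>Multiplicative relations\<close>

text \<open>A relation rather than a map: substitution into rational functions is partial, and side
  conditions such as positivity or homogeneity can be carried along.\<close>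

locale multiplicative_relation =
  fixes R :: "'a::{comm_monoid_mult,inverse} \<Rightarrow> 'b::{comm_monoid_mult,inverse} \<Rightarrow> bool"
  assumes one: "R 1 1"
    and mult: "R a b \<Longrightarrow> R a' b' \<Longrightarrow> R (a * a') (b * b')"
    and inv: "R a b \<Longrightarrow> R (inverse a) (inverse b)"
begin

lemma power: "R a b \<Longrightarrow> R (a ^ m) (b ^ m)"
  by (induction m) (auto intro: one mult)

lemma powi: "R a b \<Longrightarrow> R (a powi n) (b powi n)"
  by (simp add: power_int_def power inv)

lemma prod: "(\<And>i. i \<in> I \<Longrightarrow> R (f i) (g i)) \<Longrightarrow> R (\<Prod>i\<in>I. f i) (\<Prod>i\<in>I. g i)"
  by (induction I rule: infinite_finite_induct) (auto intro: one mult)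

end

section \<open>The recursions for matrices, coefficients and cluster variables\<close>

context
  fixes B :: "'n::finite \<Rightarrow> 'n \<Rightarrow> int" and d :: "'n \<Rightarrow> nat"
begin

text \<open>A vertex is given here by its label sequence read backwards: the last mutation is at the
  head of the list \<open>w\<close>, so \<open>w\<close> stands for the vertex \<open>rev w\<close>.\<close>

primrec exch_mat :: "'n list \<Rightarrow> 'n \<Rightarrow> 'n \<Rightarrow> int" where
  "exch_mat [] = B"
| "exch_mat (k # w) = (\<lambda>i j. if i = k \<or> j = k then - exch_mat w i j
     else exch_mat w i j + pos_part (exch_mat w i k) * int (d k) * exch_mat w k j
       + exch_mat w i k * int (d k) * pos_part (- exch_mat w k j))"

text \<open>The last two summands are the tropical exponents of \<open>(y_k^d_k)^[b_kj]_+\<close>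
  and of \<open>Z_k(y_k)^(- b_kj)\<close>, since the minimum of \<open>s * c_ik\<close> over
  \<open>0 \<le> s \<le> d_k\<close> is \<open>- d_k * [- c_ik]_+\<close>. This form is valid for
  every sign pattern of a column.\<close>

primrec c_mat :: "'n list \<Rightarrow> 'n \<Rightarrow> 'n \<Rightarrow> int" where
  "c_mat [] = (\<lambda>i j. if i = j then 1 else 0)"
| "c_mat (k # w) = (\<lambda>i j. if j = k then - c_mat w i k
     else c_mat w i j + int (d k) * c_mat w i k * pos_part (exch_mat w k j)
       + int (d k) * pos_part (- c_mat w i k) * exch_mat w k j)"

text \<open>The separation formula. If \<open>f\<close> consists of the \<open>X\<close>-functions,
  it gives \<open>yhat\<close> at the vertex; if \<open>f\<close> consists of the values of the
  \<open>F\<close>-polynomials in the semifield, it gives the coefficients at the vertex.\<close>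

definition coeff_rec :: "('n \<Rightarrow> 'a::{comm_monoid_mult,inverse}) \<Rightarrow> ('n \<Rightarrow> 'a) \<Rightarrow> 'n list \<Rightarrow> 'n \<Rightarrow> 'a" where
  "coeff_rec y f w j = (\<Prod>i\<in>UNIV. y i powi c_mat w i j) * (\<Prod>i\<in>UNIV. f i powi exch_mat w i j)"

text \<open>The exchange relation with tropical coefficients. The exchange polynomial
  \<open>Q w k\<close> is left arbitrary: \<open>x\<close>-functions, \<open>F\<close>-polynomials, their values in fields and
  semifields, and \<open>g\<close>-vectors (for the constant \<open>1\<close>) are all instances.\<close>

primrec cluster_rec :: "('n \<Rightarrow> 'a::{comm_monoid_mult,inverse}) \<Rightarrow> ('n \<Rightarrow> 'a) \<Rightarrow>
    ('n list \<Rightarrow> 'n \<Rightarrow> 'a \<Rightarrow> 'a) \<Rightarrow> 'n list \<Rightarrow> 'n \<Rightarrow> 'a" where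
  "cluster_rec x y Q [] = x"
| "cluster_rec x y Q (k # w) = (cluster_rec x y Q w)(k :=
     inverse (cluster_rec x y Q w k)
     * (\<Prod>i\<in>UNIV. cluster_rec x y Q w i powi pos_part (- exch_mat w i k)) ^ d k
     * (\<Prod>i\<in>UNIV. y i powi pos_part (- c_mat w i k)) ^ d k
     * Q w k (coeff_rec y (cluster_rec x y Q w) w k))"

lemma coeff_rec_Nil: "coeff_rec y f [] j = y j * (\<Prod>i\<in>UNIV. f i powi B i j)"
proof -
  have "(\<Prod>i\<in>UNIV. y i powi (if i = j then 1 else 0)) = (\<Prod>i\<in>UNIV. if i = j then y i else 1)"
    by (rule prod.cong) (auto simp: power_int_def)
  then show ?thesis by (simp add: coeff_rec_def)
qed

lemma coeff_rec_related:
  assumes R: "multiplicative_relation R" and "\<And>i. R (y i) (y' i)" "\<And>i. R (f i) (f' i)"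
  shows "R (coeff_rec y f w j) (coeff_rec y' f' w j)"
proof -
  interpret multiplicative_relation R by (rule R)
  show ?thesis unfolding coeff_rec_def by (intro mult prod powi assms(2,3))
qed

text \<open>The exchange polynomials have to respect \<open>R\<close> only at the arguments that
  occur along the recursion. For \<open>g\<close>-vectors this matters: the tropical argument there
  is always 1.\<close>

lemma cluster_rec_related:
  assumes R: "multiplicative_relation R" and x: "\<And>i. R (x i) (x' i)" and y: "\<And>i. R (y i) (y' i)"
    and Q: "\<And>w k. R (coeff_rec y (cluster_rec x y Q w) w k)
        (coeff_rec y' (cluster_rec x' y' Q' w) w k) \<Longrightarrow>
      R (Q w k (coeff_rec y (cluster_rec x y Q w) w k))
        (Q' w k (coeff_rec y' (cluster_rec x' y' Q' w) w k))"
  shows "R (cluster_rec x y Q w i) (cluster_rec x' y' Q' w i)"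
proof (induction w arbitrary: i)
  case Nil
  show ?case by (simp add: x)
next
  case (Cons k w)
  interpret multiplicative_relation R by (rule R)
  let ?f = "cluster_rec x y Q w" and ?f' = "cluster_rec x' y' Q' w"
  have "R (coeff_rec y ?f w k) (coeff_rec y' ?f' w k)"
    by (rule coeff_rec_related[OF R]) (rule y, rule Cons.IH)
  then have q: "R (Q w k (coeff_rec y ?f w k)) (Q' w k (coeff_rec y' ?f' w k))"
    by (rule Q)
  have f: "R (\<Prod>i\<in>UNIV. ?f i powi pos_part (- exch_mat w i k))
      (\<Prod>i\<in>UNIV. ?f' i powi pos_part (- exch_mat w i k))"
    by (rule prod) (rule powi, rule Cons.IH)
  have y': "R (\<Prod>i\<in>UNIV. y i powi pos_part (- c_mat w i k))
      (\<Prod>i\<in>UNIV. y' i powi pos_part (- c_mat w i k))"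
    by (rule prod) (rule powi, rule y)
  have "R (cluster_rec x y Q (k # w) k) (cluster_rec x' y' Q' (k # w) k)"
    unfolding cluster_rec.simps fun_upd_same
    by (rule mult[OF mult[OF mult[OF inv[OF Cons.IH[of k]] power[OF f]] power[OF y']] q])
  then show ?case
    by (cases "i = k") (simp_all only: cluster_rec.simps fun_upd_other Cons.IH not_False_eq_True)
qed

text \<open>Mutation keeps the symmetrizer \<open>r\<close>: after multiplication by
  \<open>r\<close>, exchanging \<open>i\<close> and \<open>j\<close> exchanges the two correction
  terms up to sign.\<close>

lemma exch_mat_skew:
  assumes r: "\<And>i. r i > 0" and B: "\<And>i j. r i * B i j = - (r j * B j i)"
  shows "r i * exch_mat w i j = - (r j * exch_mat w j i)"
proof (induction w arbitrary: i j)
  case Nil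
  show ?case by (simp only: exch_mat.simps B[of i j])
next
  case (Cons k w)
  have pos: "r i * pos_part a = pos_part (r i * a)" for i a
  proof (cases "a \<ge> 0")
    case True
    then show ?thesis using r[of i] by (simp add: pos_part_def)
  next
    case False
    then have "r i * a \<le> 0" using r[of i] by (simp add: mult_le_0_iff)
    with False show ?thesis by (simp add: pos_part_def)
  qed
  let ?b = "exch_mat w"
  have rpos: "r i * pos_part (?b i k) = r k * pos_part (- ?b k i)" for i
    unfolding pos Cons.IH[of i k] mult_minus_right ..
  have swap: "r i * (pos_part (?b i k) * int (d k) * ?b k j)
      = - (r j * (?b j k * int (d k) * pos_part (- ?b k i)))" for i j
  proof -
    have "r i * (pos_part (?b i k) * int (d k) * ?b k j)
        = (r i * pos_part (?b i k)) * int (d k) * ?b k j"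
      by (simp only: ac_simps)
    also have "\<dots> = pos_part (- ?b k i) * int (d k) * (r k * ?b k j)"
      unfolding rpos by (simp only: ac_simps)
    also have "\<dots> = - (r j * (?b j k * int (d k) * pos_part (- ?b k i)))"
      unfolding Cons.IH[of k j] by simp
    finally show ?thesis .
  qed
  show ?case
  proof (cases "i = k \<or> j = k")
    case True
    then show ?thesis using Cons.IH[of i j] by auto
  next
    case False
    then have "r i * exch_mat (k # w) i j = r i * ?b i j
        + r i * (pos_part (?b i k) * int (d k) * ?b k j)
        + r i * (?b i k * int (d k) * pos_part (- ?b k j))"
      "r j * exch_mat (k # w) j i = r j * ?b j i
        + r j * (pos_part (?b j k) * int (d k) * ?b k i)
        + r j * (?b j k * int (d k) * pos_part (- ?b k i))"
      by (simp_all add: distrib_left)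
    then show ?thesis using Cons.IH[of i j] swap[of i j] swap[of j i] by linarith
  qed
qed

text \<open>A zero diagonal keeps the variable being replaced out of its own exchange monomial and
  out of the coefficient in that direction.\<close>

lemma exch_mat_diagonal:
  assumes "skew_symmetrizable B"
  shows "exch_mat w i i = 0"
proof -
  from assms obtain r :: "'n \<Rightarrow> int" where
    r: "\<And>i. r i > 0" "\<And>i j. r i * B i j = - (r j * B j i)"
    unfolding skew_symmetrizable_def by blast
  from exch_mat_skew[OF r, where w = w and i = i and j = i] have "r i * exch_mat w i i = 0" by simp
  with r(1)[of i] show ?thesis by simp
qed

text \<open>The \<open>y\<close>-mutation rule follows from the exchange relations alone, whatever the
  exchange polynomials.\<close>

lemma coeff_rec_mutation:
  fixes x y :: "'n \<Rightarrow> 'p::semifield" and Q :: "'n list \<Rightarrow> 'n \<Rightarrow> 'p \<Rightarrow> 'p" and w :: "'n list" and k :: 'n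
  assumes skew: "skew_symmetrizable B"
  defines "f \<equiv> cluster_rec x y Q w" and "f' \<equiv> cluster_rec x y Q (k # w)"
  shows "coeff_rec y f' (k # w) j = (if j = k then inverse (coeff_rec y f w k)
      else coeff_rec y f w j * (coeff_rec y f w k ^ d k) powi pos_part (exch_mat w k j)
        * Q w k (coeff_rec y f w k) powi (- exch_mat w k j))"
proof (cases "j = k")
  case True
  \<comment> \<open>Only the factor \<open>i = k\<close> could differ, and its exponent is
    0.\<close>
  have "f' i powi - exch_mat w i k = f i powi - exch_mat w i k" for i
    by (cases "i = k") (auto simp: f_def f'_def exch_mat_diagonal[OF skew])
  with True show ?thesis
    by (simp add: coeff_rec_def semifield_prod_powi_minus semifield_inverse_mult)
next
  case False
  let ?b = "exch_mat w" and ?c = "c_mat w"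
  let ?m = "int (d k) * ?b k j" and ?p = "int (d k) * pos_part (?b k j)"
  let ?q = "Q w k (coeff_rec y f w k)"
  let ?Mf = "\<Prod>i\<in>UNIV. f i powi pos_part (- ?b i k)"
  let ?My = "\<Prod>i\<in>UNIV. y i powi pos_part (- ?c i k)"
  let ?e = "\<lambda>i. ?b i j + pos_part (?b i k) * int (d k) * ?b k j
      + ?b i k * int (d k) * pos_part (- ?b k j)"
  have pos: "pos_part a - pos_part (- a) = a" for a by (simp add: pos_part_def)
  \<comment> \<open>The power of \<open>?Mf\<close> comes from \<open>f' k\<close> raised to
    \<open>- ?b k j\<close>. By \<open>[b]_+ - [- b]_+ = b\<close>, used for \<open>b_ik\<close> and
    for \<open>b_kj\<close>, it turns the mutated exponents into the old ones plus a multiple of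
    column \<open>k\<close>.\<close>
  have F: "(\<Prod>i\<in>UNIV. f i powi ?e i) * ?Mf powi (- ?m)
      = (\<Prod>i\<in>UNIV. f i powi ?b i j) * (\<Prod>i\<in>UNIV. f i powi ?b i k) powi ?p"
  proof -
    have "?e i + pos_part (- ?b i k) * (- ?m) = ?b i j + ?b i k * ?p" for i
    proof -
      have "pos_part (?b i k) = ?b i k + pos_part (- ?b i k)"
        "pos_part (?b k j) = ?b k j + pos_part (- ?b k j)"
        using pos[of "?b i k"] pos[of "?b k j"] by simp_all
      then show ?thesis by (simp only:) (simp add: algebra_simps)
    qed
    then show ?thesis
      by (simp only: semifield_powi_prod prod.distrib[symmetric] semifield_powi_mult[symmetric]
          semifield_powi_add[symmetric])
  qed
  have Y: "(\<Prod>i\<in>UNIV. y i powi c_mat (k # w) i j) * ?My powi (- ?m)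
      = (\<Prod>i\<in>UNIV. y i powi ?c i j) * (\<Prod>i\<in>UNIV. y i powi ?c i k) powi ?p"
  proof -
    have "c_mat (k # w) i j + pos_part (- ?c i k) * (- ?m) = ?c i j + ?c i k * ?p" for i
      using False by (simp add: algebra_simps)
    then show ?thesis
      by (simp only: semifield_powi_prod prod.distrib[symmetric] semifield_powi_mult[symmetric]
          semifield_powi_add[symmetric])
  qed
  have f'k: "f' k = inverse (f k) * ?Mf ^ d k * ?My ^ d k * ?q"
    by (simp add: f'_def f_def)
  have "f' k powi (- ?b k j) = f k powi ?b k j * ?Mf powi (- ?m) * ?My powi (- ?m) * ?q powi (- ?b k j)"
    unfolding f'k semifield_power_eq_powi semifield_powi_mult_distrib semifield_powi_mult[symmetric]
    by (simp add: semifield_inverse_powi semifield_powi_minus semifield_inverse_inverse)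
  moreover have "(\<Prod>i\<in>UNIV. f' i powi exch_mat (k # w) i j)
      = f' k powi (- ?b k j) * (\<Prod>i\<in>UNIV - {k}. f i powi ?e i)"
  proof -
    have "(\<Prod>i\<in>UNIV - {k}. f' i powi exch_mat (k # w) i j) = (\<Prod>i\<in>UNIV - {k}. f i powi ?e i)"
      by (rule prod.cong) (use False in \<open>auto simp: f'_def f_def\<close>)
    then show ?thesis
      by (subst prod.remove[of _ k]) auto
  qed
  \<comment> \<open>The inverse of \<open>f k\<close> inside \<open>f' k\<close> supplies exactly
    the missing factor \<open>i = k\<close>, since \<open>?e k = ?b k j\<close>.\<close>
  moreover have "(\<Prod>i\<in>UNIV. f i powi ?e i) = f k powi ?b k j * (\<Prod>i\<in>UNIV - {k}. f i powi ?e i)"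
    by (subst prod.remove[of _ k]) (auto simp: exch_mat_diagonal[OF skew] pos_part_def)
  ultimately have "coeff_rec y f' (k # w) j =
      ((\<Prod>i\<in>UNIV. y i powi c_mat (k # w) i j) * ?My powi (- ?m))
      * ((\<Prod>i\<in>UNIV. f i powi ?e i) * ?Mf powi (- ?m)) * ?q powi (- ?b k j)"
    unfolding coeff_rec_def by (simp only: ac_simps)
  also have "\<dots> = coeff_rec y f w j * (coeff_rec y f w k ^ d k) powi pos_part (?b k j)
      * ?q powi (- ?b k j)"
    unfolding F Y coeff_rec_def semifield_power_eq_powi semifield_powi_mult[symmetric]
      semifield_powi_mult_distrib
    by (simp only: ac_simps)
  finally show ?thesis using False by simp
qed

end

section \<open>Seeds along a path\<close>

lemma exch_mutate_coeff [simp]: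
  "exch (mutate_coeff k S) = (\<lambda>i j. if i = k \<or> j = k then - exch S i j
     else exch S i j + pos_part (exch S i k) * int (zdeg S k) * exch S k j
       + exch S i k * int (zdeg S k) * pos_part (- exch S k j))"
  by (simp add: mutate_coeff_def)

lemma coeff_mutate_coeff:
  "coeff (mutate_coeff k S) = (\<lambda>j. if j = k then inverse (coeff S k)
     else coeff S j * (coeff S k ^ zdeg S k) powi pos_part (exch S k j)
       * exch_poly_semifield S k (coeff S k) powi (- exch S k j))"
  by (simp add: mutate_coeff_def)

lemma zdeg_mutate_coeff [simp]: "zdeg (mutate_coeff k S) = zdeg S"
  by (simp add: mutate_coeff_def)

lemma zcoeff_mutate_coeff:
  "zcoeff (mutate_coeff k S) =
     (\<lambda>i s. if i = k \<and> s \<le> zdeg S k then zcoeff S k (zdeg S k - s) else zcoeff S i s)"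
  by (simp add: mutate_coeff_def)

lemma coeff_mutate [simp]: "coeff (mutate \<iota> k S) = coeff (mutate_coeff k S)"
  and exch_mutate [simp]: "exch (mutate \<iota> k S) = exch (mutate_coeff k S)"
  and zdeg_mutate [simp]: "zdeg (mutate \<iota> k S) = zdeg S"
  and zcoeff_mutate [simp]: "zcoeff (mutate \<iota> k S) = zcoeff (mutate_coeff k S)"
  by (simp_all add: mutate_def)

lemma cluster_mutate:
  "cluster (mutate \<iota> k S) = (cluster S)(k :=
     (\<Prod>j\<in>UNIV. cluster S j powi pos_part (- exch S j k)) ^ zdeg S k
       * exch_poly_field \<iota> S k (yhat \<iota> S k)
       / \<iota> (exch_poly_semifield S k (coeff S k)) / cluster S k)"
  by (auto simp: mutate_def)

lemma truncate_sels:
  "coeff (yseed.truncate S) = coeff S" "exch (yseed.truncate S) = exch S"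
  "zdeg (yseed.truncate S) = zdeg S" "zcoeff (yseed.truncate S) = zcoeff S"
  by (simp_all add: yseed.truncate_def)

lemma truncate_mutate: "yseed.truncate (mutate \<iota> k S) = mutate_coeff k (yseed.truncate S)"
  by (rule yseed.equality)
    (simp_all add: truncate_sels coeff_mutate_coeff zcoeff_mutate_coeff exch_poly_semifield_def
      cong: if_cong)

lemma yseed_at_Cons [simp]: "yseed_at S (rev w @ [k]) = mutate_coeff k (yseed_at S (rev w))"
  by (simp add: yseed_at_def)

lemma yseed_at_Nil [simp]: "yseed_at S [] = S"
  by (simp add: yseed_at_def)

lemma seed_at_Cons [simp]: "seed_at \<iota> S (rev w @ [k]) = mutate \<iota> k (seed_at \<iota> S (rev w))"
  by (simp add: seed_at_def)

lemma seed_at_Nil [simp]: "seed_at \<iota> S [] = S"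
  by (simp add: seed_at_def)

lemma truncate_seed_at:
  "yseed.truncate (seed_at \<iota> S (rev w)) = yseed_at (yseed.truncate S) (rev w)"
  by (induction w) (simp_all add: truncate_mutate)

lemma seed_at_sels:
  "coeff (seed_at \<iota> S (rev w)) = coeff (yseed_at (yseed.truncate S) (rev w))"
  "exch (seed_at \<iota> S (rev w)) = exch (yseed_at (yseed.truncate S) (rev w))"
  "zdeg (seed_at \<iota> S (rev w)) = zdeg (yseed_at (yseed.truncate S) (rev w))"
  "zcoeff (seed_at \<iota> S (rev w)) = zcoeff (yseed_at (yseed.truncate S) (rev w))"
  by (simp_all add: truncate_seed_at[symmetric, where \<iota> = \<iota>] truncate_sels)

lemma zdeg_yseed_at [simp]: "zdeg (yseed_at S (rev w)) = zdeg S"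
  by (induction w) auto

lemma exch_yseed_at: "exch (yseed_at S (rev w)) = exch_mat (exch S) (zdeg S) w"
  by (induction w) (auto simp: fun_eq_iff)

lemma zdeg_seed_at [simp]: "zdeg (seed_at \<iota> S (rev w)) = zdeg S"
  by (simp add: seed_at_sels truncate_sels)

lemma exch_seed_at: "exch (seed_at \<iota> S (rev w)) = exch_mat (exch S) (zdeg S) w"
  by (simp add: seed_at_sels truncate_sels exch_yseed_at)

section \<open>Coefficients in the tropical semifield\<close>

lemma trop_eqI:
  "(\<And>v. Poly_Mapping.lookup (trop_exponent a) v = Poly_Mapping.lookup (trop_exponent b) v) \<Longrightarrow> a = b"
  by (metis poly_mapping_eqI trop.expand)

abbreviation texp :: "'v trop \<Rightarrow> 'v \<Rightarrow> int" where
  "texp a \<equiv> Poly_Mapping.lookup (trop_exponent a)"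

lemma texp_one [simp]: "texp 1 v = 0"
  by (simp add: one_trop_def)

lemma texp_mult [simp]: "texp (a * b) v = texp a v + texp b v"
  by (simp add: times_trop_def lookup_add)

lemma texp_add [simp]: "texp (a + b) v = min (texp a v) (texp b v)"
  by (simp add: plus_trop_def pointwise_min.rep_eq)

lemma texp_inverse [simp]: "texp (inverse a) v = - texp a v"
  by (simp add: inverse_trop_def)

lemma texp_power [simp]: "texp (a ^ m) v = int m * texp a v"
  by (induction m) (auto simp: algebra_simps)

lemma texp_powi [simp]: "texp (a powi n) v = n * texp a v"
  by (simp add: power_int_def)

lemma texp_prod [simp]: "texp (\<Prod>i\<in>I. f i) v = (\<Sum>i\<in>I. texp (f i) v)"
  by (induction I rule: infinite_finite_induct) auto

lemma texp_trop_var: "texp (trop_var u) v = (if u = v then 1 else 0)"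
  by (simp add: trop_var_def lookup_single when_def)

lemma texp_oplus_upto:
  assumes "\<And>s. s \<le> m \<Longrightarrow> e \<le> texp (f s) v" and "\<exists>s\<le>m. texp (f s) v = e"
  shows "texp (oplus_upto f m) v = e"
proof -
  have "texp (oplus_upto f m) v \<le> texp (f s) v" if "s \<le> m" for s
    using that
  proof (induction m)
    case (Suc m)
    then show ?case by (cases "s = Suc m") (auto simp: min_le_iff_disj)
  qed simp
  moreover have "e \<le> texp (oplus_upto f m) v"
    using assms(1) by (induction m) auto
  ultimately show ?thesis using assms(2) by force
qed

definition ymon :: "('n::finite \<Rightarrow> int) \<Rightarrow> 'n cvar trop" where
  "ymon c = (\<Prod>i\<in>UNIV. trop_var (Yvar i) powi c i)"

lemma texp_ymon_Yvar [simp]: "texp (ymon c) (Yvar i) = c i"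
proof -
  have "texp (ymon c) (Yvar i) = (\<Sum>j\<in>UNIV. if j = i then c i else 0)"
    unfolding ymon_def texp_prod texp_powi texp_trop_var by (rule sum.cong) auto
  then show ?thesis by simp
qed

lemma texp_ymon_Zvar [simp]: "texp (ymon c) (Zvar i s) = 0"
  by (simp add: ymon_def texp_trop_var)

lemma ymon_eqI: "(\<And>i. texp a (Yvar i) = c i) \<Longrightarrow> (\<And>i s. texp a (Zvar i s) = 0) \<Longrightarrow> a = ymon c"
  by (rule trop_eqI) (metis cvar.exhaust texp_ymon_Yvar texp_ymon_Zvar)

text \<open>The coefficients stay monomials in \<open>y\<close> alone. Mutation in direction
  \<open>k\<close> reverses the coefficients of \<open>Z_k\<close>, whence an inner one is only
  known to be \<open>Zvar k r\<close> for some \<open>r\<close>.\<close>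

definition formal_seed_inv ::
    "('n::finite \<Rightarrow> 'n \<Rightarrow> int) \<Rightarrow> ('n \<Rightarrow> nat) \<Rightarrow> 'n list \<Rightarrow> ('n, 'n cvar trop) yseed \<Rightarrow> bool" where
  "formal_seed_inv B d w S \<longleftrightarrow> exch S = exch_mat B d w \<and> zdeg S = d \<and>
     (\<forall>j. coeff S j = ymon (\<lambda>i. c_mat B d w i j)) \<and>
     (\<forall>k. zcoeff S k 0 = 1 \<and> zcoeff S k (d k) = 1 \<and>
       (\<forall>s. 0 < s \<and> s < d k \<longrightarrow> (\<exists>r. zcoeff S k s = trop_var (Zvar k r))))"

text \<open>A tropical sum takes minima of exponents. At \<open>y_i\<close> the exponent of the
  \<open>s\<close>-th term is linear in \<open>s\<close>, so the minimum sits at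
  \<open>s = 0\<close> or \<open>s = d k\<close>; at a \<open>z\<close>-variable all exponents are
  nonnegative and \<open>s = 0\<close> gives 0.\<close>

lemma exch_poly_tropical:
  assumes "formal_seed_inv B d w S"
  shows "exch_poly_semifield S k (coeff S k) =
    ymon (\<lambda>i. - (int (d k) * pos_part (- c_mat B d w i k)))"
proof (rule ymon_eqI)
  have d: "zdeg S = d" and y: "coeff S k = ymon (\<lambda>i. c_mat B d w i k)"
    and z: "zcoeff S k 0 = 1" "zcoeff S k (d k) = 1"
    and z': "\<And>s. 0 < s \<Longrightarrow> s < d k \<Longrightarrow> \<exists>r. zcoeff S k s = trop_var (Zvar k r)"
    using assms by (auto simp: formal_seed_inv_def)
  fix i
  have zY: "texp (zcoeff S k s) (Yvar i) = 0" if s: "s \<le> d k" for s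
  proof -
    consider "zcoeff S k s = 1" | r where "zcoeff S k s = trop_var (Zvar k r)"
      using s z z'[of s] by (metis le_neq_implies_less not_gr_zero)
    then show ?thesis by cases (simp_all add: texp_trop_var)
  qed
  show "texp (exch_poly_semifield S k (coeff S k)) (Yvar i)
      = - (int (d k) * pos_part (- c_mat B d w i k))"
    unfolding exch_poly_semifield_def d
  proof (rule texp_oplus_upto)
    fix s assume s: "s \<le> d k"
    let ?c = "c_mat B d w i k"
    show "- (int (d k) * pos_part (- ?c)) \<le> texp (zcoeff S k s * coeff S k ^ s) (Yvar i)"
    proof (cases "?c \<ge> 0")
      case True
      then show ?thesis using s by (simp add: zY y pos_part_def)
    next
      case False
      with s have "int (d k) * ?c \<le> int s * ?c" by (intro mult_right_mono_neg) auto
      with False show ?thesis using s by (simp add: zY y pos_part_def)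
    qed
  next
    let ?c = "c_mat B d w i k"
    show "\<exists>s\<le>d k. texp (zcoeff S k s * coeff S k ^ s) (Yvar i) = - (int (d k) * pos_part (- ?c))"
    proof (cases "?c \<ge> 0")
      case True
      then show ?thesis by (intro exI[of _ 0]) (simp add: z pos_part_def)
    next
      case False
      then show ?thesis by (intro exI[of _ "d k"]) (simp add: z y pos_part_def)
    qed
  qed
  fix r
  have zZ: "texp (zcoeff S k s) (Zvar i r) \<ge> 0" if s: "s \<le> d k" for s
  proof -
    consider "zcoeff S k s = 1" | r where "zcoeff S k s = trop_var (Zvar k r)"
      using s z z'[of s] by (metis le_neq_implies_less not_gr_zero)
    then show ?thesis by cases (simp_all add: texp_trop_var)
  qed
  show "texp (exch_poly_semifield S k (coeff S k)) (Zvar i r) = 0"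
    unfolding exch_poly_semifield_def d
    by (rule texp_oplus_upto) (use z in \<open>auto simp: zZ y intro!: exI[of _ 0]\<close>)
qed

lemma formal_seed_inv_mutate:
  assumes "formal_seed_inv B d w S"
  shows "formal_seed_inv B d (k # w) (mutate_coeff k S)"
proof -
  have d: "zdeg S = d" and b: "exch S = exch_mat B d w"
    and y: "\<And>j. coeff S j = ymon (\<lambda>i. c_mat B d w i j)"
    and z: "\<And>k. zcoeff S k 0 = 1" "\<And>k. zcoeff S k (d k) = 1"
      "\<And>k s. 0 < s \<Longrightarrow> s < d k \<Longrightarrow> \<exists>r. zcoeff S k s = trop_var (Zvar k r)"
    using assms by (auto simp: formal_seed_inv_def)
  have "coeff (mutate_coeff k S) j = ymon (\<lambda>i. c_mat B d (k # w) i j)" for j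
    unfolding coeff_mutate_coeff exch_poly_tropical[OF assms]
    by (rule ymon_eqI) (auto simp: y d b algebra_simps)
  then show ?thesis
    using z by (auto simp: formal_seed_inv_def d b zcoeff_mutate_coeff cong: if_cong)
qed

lemma formal_seed_inv:
  "formal_seed_inv B d w (yseed_at (formal_yseed trop_var B d) (rev w))"
proof (induction w)
  case Nil
  have "trop_var (Yvar j) = ymon (\<lambda>i. c_mat B d [] i j)" for j
    by (rule ymon_eqI) (auto simp: texp_trop_var)
  then show ?case by (auto simp: formal_seed_inv_def formal_yseed_def)
next
  case (Cons k w)
  then show ?case by (simp add: formal_seed_inv_mutate)
qed

section \<open>Change of the coefficient semifield\<close>

definition yseed_image :: "('p \<Rightarrow> 'q) \<Rightarrow> ('n, 'p) yseed \<Rightarrow> ('n, 'q) yseed" where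
  "yseed_image h S = \<lparr> coeff = (\<lambda>j. h (coeff S j)), exch = exch S, zdeg = zdeg S,
     zcoeff = (\<lambda>i s. h (zcoeff S i s)) \<rparr>"

lemma semifield_hom_relation:
  "semifield_hom h \<Longrightarrow> multiplicative_relation (\<lambda>a b. b = h a)"
  by unfold_locales (simp_all add: semifield_hom_one semifield_hom_mult semifield_hom_inverse)

lemma semifield_hom_power: "semifield_hom h \<Longrightarrow> h (a ^ m) = h a ^ m"
  using multiplicative_relation.power[OF semifield_hom_relation, of h "h a" a] by simp

lemma semifield_hom_powi: "semifield_hom h \<Longrightarrow> h (a powi n) = h a powi n"
  using multiplicative_relation.powi[OF semifield_hom_relation, of h "h a" a] by simp

lemma semifield_hom_oplus_upto: "semifield_hom h \<Longrightarrow> h (oplus_upto f m) = oplus_upto (\<lambda>s. h (f s)) m"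
  by (induction m) (simp_all add: semifield_hom_add)

lemma yseed_image_mutate:
  assumes "semifield_hom h"
  shows "yseed_image h (mutate_coeff k S) = mutate_coeff k (yseed_image h S)"
  using assms
  by (simp add: mutate_coeff_def yseed_image_def exch_poly_semifield_def fun_eq_iff
      semifield_hom_mult semifield_hom_inverse semifield_hom_powi semifield_hom_power
      semifield_hom_oplus_upto)

lemma yseed_image_yseed_at:
  "semifield_hom h \<Longrightarrow> yseed_image h (yseed_at S (rev w)) = yseed_at (yseed_image h S) (rev w)"
  by (induction w) (simp_all add: yseed_image_mutate)

text \<open>Tropical evaluation is a homomorphism of semifields and so commutes with coefficient
  mutation: tropicalizing the \<open>Y\<close>-functions amounts to mutating the tropical
  seed.\<close>

lemma c_vec_eq_c_mat: "c_vec B d (rev w) i j = c_mat B d w i j"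
proof -
  let ?h = "qsf_eval trop_var :: 'a cvar qsf \<Rightarrow> 'a cvar trop"
  have hom: "semifield_hom ?h" and var: "\<And>v. ?h (qsf_var v) = trop_var v"
    by (simp_all add: qsf_eval_hom_var)
  have "yseed_image ?h (formal_yseed qsf_var B d) = formal_yseed trop_var B d"
    by (auto simp: yseed_image_def formal_yseed_def var fun_eq_iff semifield_hom_one[OF hom])
  then have "?h (Y_fun B d (rev w) j) = coeff (yseed_at (formal_yseed trop_var B d) (rev w)) j"
    unfolding Y_fun_def by (metis yseed_image_yseed_at[OF hom] yseed_image_def yseed.select_convs(1))
  then show ?thesis
    using formal_seed_inv[of B d w] by (simp add: c_vec_def formal_seed_inv_def)
qed

section \<open>The cluster variables with principal coefficients\<close>

lemma trop_monomial_superset: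
  assumes "finite A" "\<And>v. v \<notin> A \<Longrightarrow> texp a v = 0"
  shows "trop_monomial a = (\<Prod>v\<in>A. ratvar (Cvar v) powi texp a v)"
  unfolding trop_monomial_def
  by (rule prod.mono_neutral_left) (use assms in \<open>auto simp: in_keys_iff\<close>)

lemma trop_monomial_ymon:
  "trop_monomial (ymon c) = (\<Prod>i\<in>UNIV. ratvar (Cvar (Yvar i)) powi c i)"
proof -
  have "trop_monomial (ymon c) = (\<Prod>v\<in>range Yvar. ratvar (Cvar v) powi texp (ymon c) v)"
    by (rule trop_monomial_superset) (simp, metis cvar.exhaust rangeI texp_ymon_Zvar)
  also have "\<dots> = (\<Prod>i\<in>UNIV. ratvar (Cvar (Yvar i)) powi c i)"
    by (subst prod.reindex) (auto simp: inj_on_def)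
  finally show ?thesis .
qed

lemma trop_monomial_one [simp]: "trop_monomial 1 = 1"
  by (simp add: trop_monomial_superset[of "{}"])

lemma trop_monomial_trop_var [simp]: "trop_monomial (trop_var v) = ratvar (Cvar v)"
  by (subst trop_monomial_superset[of "{v}"]) (auto simp: texp_trop_var)

definition formal_zcoeff ::
    "('n::finite \<Rightarrow> 'n \<Rightarrow> int) \<Rightarrow> ('n \<Rightarrow> nat) \<Rightarrow> 'n list \<Rightarrow> 'n \<Rightarrow> nat \<Rightarrow> 'n cvar trop" where
  "formal_zcoeff B d w = zcoeff (yseed_at (formal_yseed trop_var B d) (rev w))"

lemma formal_zcoeff_cases:
  assumes "s \<le> d k"
  obtains "s = 0 \<or> s = d k" "formal_zcoeff B d w k s = 1"
  | r where "0 < s" "s < d k" "formal_zcoeff B d w k s = trop_var (Zvar k r)"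
proof -
  note z = formal_seed_inv[of B d w, unfolded formal_seed_inv_def formal_zcoeff_def[symmetric]]
  show ?thesis
  proof (cases "s = 0 \<or> s = d k")
    case True
    then show ?thesis using z that(1) by blast
  next
    case False
    with assms have "0 < s" "s < d k" by auto
    with z show ?thesis using that(2) by blast
  qed
qed

text \<open>The map \<open>\<iota>\<close> is left open because the sum occurs twice: with
  \<open>trop_monomial\<close> for the \<open>X\<close>-functions and with \<open>coeff_x1\<close>
  after setting \<open>x = 1\<close>.\<close>

definition formal_exch_poly ::
    "('n cvar trop \<Rightarrow> 'f::field) \<Rightarrow> ('n::finite \<Rightarrow> 'n \<Rightarrow> int) \<Rightarrow> ('n \<Rightarrow> nat) \<Rightarrow> 'n list \<Rightarrow> 'n \<Rightarrow> 'f \<Rightarrow> 'f" where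
  "formal_exch_poly \<iota> B d w k u = (\<Sum>s\<le>d k. \<iota> (formal_zcoeff B d w k s) * u ^ s)"

text \<open>Dividing by the tropical value of \<open>Z_k\<close> multiplies by a monomial in
  \<open>y\<close> with nonnegative exponents; it is the \<open>y\<close>-factor of
  \<open>cluster_rec\<close>.\<close>

lemma X_fun_eq_cluster_rec:
  fixes B :: "'n::finite \<Rightarrow> 'n \<Rightarrow> int"
  shows "X_fun B d (rev w) j = cluster_rec B d (\<lambda>i. ratvar (Xvar i)) (\<lambda>i. ratvar (Cvar (Yvar i)))
     (formal_exch_poly trop_monomial B d) w j"
proof (induction w arbitrary: j)
  case Nil
  show ?case by (simp add: X_fun_def yseed.defs seed.defs)
next
  case (Cons k w)
  let ?f = "cluster_rec B d (\<lambda>i. ratvar (Xvar i)) (\<lambda>i. ratvar (Cvar (Yvar i)))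
     (formal_exch_poly trop_monomial B d) w"
  define T0 where
    "T0 = yseed.extend (formal_yseed trop_var B d) (seed.fields (\<lambda>i :: 'n. ratvar (Xvar i)))"
  let ?T = "seed_at trop_monomial T0 (rev w)" and ?S = "yseed_at (formal_yseed trop_var B d) (rev w)"
  have T0: "yseed.truncate T0 = formal_yseed trop_var B d"
    by (simp add: T0_def yseed.defs seed.defs formal_yseed_def)
  note inv = formal_seed_inv[of B d w, unfolded formal_seed_inv_def]
  have T: "coeff ?T = coeff ?S" "zdeg ?T = d" "exch ?T = exch_mat B d w" "zcoeff ?T = zcoeff ?S"
    using inv by (simp_all only: seed_at_sels T0)
  have zdeg_T0 [simp]: "zdeg T0 = d"
    by (simp add: T0_def yseed.defs seed.defs formal_yseed_def)
  have f: "cluster ?T = ?f"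
    using Cons.IH by (auto simp: X_fun_def T0_def fun_eq_iff)
  have Z: "exch_poly_semifield ?T k (coeff ?T k) =
      ymon (\<lambda>i. - (int (d k) * pos_part (- c_mat B d w i k)))"
    using exch_poly_tropical[OF formal_seed_inv[of B d w], of k] inv
    by (simp only: exch_poly_semifield_def T)
  have y: "coeff ?S k = ymon (\<lambda>i. c_mat B d w i k)"
    using inv by blast
  have iZ: "inverse (trop_monomial (exch_poly_semifield ?T k (coeff ?T k)))
      = (\<Prod>i\<in>UNIV. ratvar (Cvar (Yvar i)) powi pos_part (- c_mat B d w i k)) ^ d k"
    unfolding Z trop_monomial_ymon
    by (simp add: prod_inversef[symmetric] prod_power_distrib power_int_minus power_int_mult
        mult.commute[of "int _"])
  have yh: "yhat trop_monomial ?T k = coeff_rec B d (\<lambda>i. ratvar (Cvar (Yvar i))) ?f w k"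
    unfolding yhat_def T y trop_monomial_ymon coeff_rec_def f ..
  have "exch_poly_field trop_monomial ?T k = formal_exch_poly trop_monomial B d w k"
    by (rule ext) (simp add: exch_poly_field_def formal_exch_poly_def formal_zcoeff_def T)
  then show ?case
    by (auto simp: X_fun_def T0_def[symmetric] cluster_mutate f yh T divide_inverse iZ[unfolded T])
qed

section \<open>\<open>F\<close>-polynomials\<close>

text \<open>Subtraction-freeness in abstract form: sums and products of members stay inside and
  therefore never vanish.\<close>

locale positive_cone =
  fixes K :: "'c::idom set"
  assumes one_in: "1 \<in> K"
    and add_in: "a \<in> K \<Longrightarrow> b \<in> K \<Longrightarrow> a + b \<in> K"
    and mult_in: "a \<in> K \<Longrightarrow> b \<in> K \<Longrightarrow> a * b \<in> K"
    and zero_notin: "0 \<notin> K"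

sublocale positive_cone \<subseteq> nonneg: subsemiring "insert 0 K"
  by unfold_locales (auto intro: add_in mult_in)

locale positive_set = positive_cone A for A :: "'a::field set" +
  assumes inverse_in: "a \<in> A \<Longrightarrow> inverse a \<in> A"
begin

lemma power_in: "a \<in> A \<Longrightarrow> a ^ m \<in> A"
  by (induction m) (auto intro: one_in mult_in)

lemma powi_in: "a \<in> A \<Longrightarrow> a powi n \<in> A"
  by (simp add: power_int_def power_in inverse_in)

lemma prod_in: "(\<And>i. i \<in> I \<Longrightarrow> f i \<in> A) \<Longrightarrow> (\<Prod>i\<in>I. f i) \<in> A"
  by (induction I rule: infinite_finite_induct) (auto intro: one_in mult_in)

lemma sum_in: "(\<And>s. s \<le> m \<Longrightarrow> f s \<in> A) \<Longrightarrow> (\<Sum>s\<le>(m::nat). f s) \<in> A"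
  by (induction m) (auto intro: add_in)

text \<open>Membership in \<open>A\<close> travels with the value because inversion needs a nonzero
  one; \<open>evaluates\<close> by itself is not closed under \<open>inverse\<close>.\<close>

lemma evaluates_relation: "multiplicative_relation (\<lambda>f a. evaluates \<sigma> f a \<and> a \<in> A)"
  by unfold_locales
    (metis evaluates_one one_in evaluates_mult mult_in evaluates_inverse inverse_in zero_notin)+

end

lemma subtraction_free_inverse: "subtraction_free f \<Longrightarrow> subtraction_free (inverse f)"
  by (metis inverse_eq_divide subtraction_free.intros(1,5))

interpretation subfree: positive_set "Collect subtraction_free"
  by unfold_locales
    (auto intro: subtraction_free.intros subtraction_free_inverse dest: subtraction_free_nonzero)

definition spec_x1 :: "'n xvar \<Rightarrow> 'n cvar ratfun" where
  "spec_x1 v = (case v of Xvar i \<Rightarrow> 1 | Cvar u \<Rightarrow> ratvar u)"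

definition spec_z0 :: "'n cvar \<Rightarrow> 'n ratfun" where
  "spec_z0 u = (case u of Yvar i \<Rightarrow> ratvar i | Zvar i s \<Rightarrow> 0)"

definition coeff_x1 :: "'n cvar trop \<Rightarrow> 'n cvar ratfun" where
  "coeff_x1 a = ratfun_eval spec_x1 (trop_monomial a)"

lemma coeff_x1_one: "coeff_x1 1 = 1"
  by (simp add: coeff_x1_def ratfun_eval_eq evaluates_one)

lemma evaluates_ratvar_Cvar: "evaluates spec_x1 (ratvar (Cvar u)) (ratvar u)"
  using evaluates_ratvar[of spec_x1 "Cvar u"] by (simp add: spec_x1_def)

lemma coeff_x1_var: "coeff_x1 (trop_var u) = ratvar u"
  by (simp add: coeff_x1_def ratfun_eval_eq evaluates_ratvar_Cvar)

lemma F_poly_eq_cluster_rec: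
  fixes B :: "'n::finite \<Rightarrow> 'n \<Rightarrow> int"
  shows "F_poly B d (rev w) j = cluster_rec B d (\<lambda>_. 1) (\<lambda>i. ratvar (Yvar i))
     (formal_exch_poly coeff_x1 B d) w j" (is "_ = ?F w j")
proof -
  let ?R = "\<lambda>f a. evaluates spec_x1 f a \<and> a \<in> Collect subtraction_free"
  have "?R (X_fun B d (rev w) j) (?F w j)"
    unfolding X_fun_eq_cluster_rec
  proof (rule cluster_rec_related[OF subfree.evaluates_relation])
    show "?R (ratvar (Xvar i)) 1" for i
      using evaluates_ratvar[of spec_x1 "Xvar i"] by (simp add: spec_x1_def subtraction_free.intros)
    show "?R (ratvar (Cvar (Yvar i))) (ratvar (Yvar i))" for i
      by (simp add: evaluates_ratvar_Cvar subtraction_free.intros)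
    have Q: "?R (formal_exch_poly trop_monomial B d w k u) (formal_exch_poly coeff_x1 B d w k v)"
      if uv: "?R u v" for w k u v
    proof -
      have z: "?R (trop_monomial (formal_zcoeff B d w k s)) (coeff_x1 (formal_zcoeff B d w k s))"
        if "s \<le> d k" for s
        using that
        by (cases rule: formal_zcoeff_cases[of s d k B w])
          (simp_all add: coeff_x1_one coeff_x1_var evaluates_one evaluates_ratvar_Cvar
            subtraction_free.intros)
      show ?thesis
        unfolding formal_exch_poly_def
      proof (intro conjI evaluates_sum subfree.sum_in)
        show "evaluates spec_x1 (trop_monomial (formal_zcoeff B d w k s) * u ^ s)
            (coeff_x1 (formal_zcoeff B d w k s) * v ^ s)" if "s \<in> {..d k}" for s
          using that z[of s] uv by (simp add: evaluates_mult evaluates_power)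
        show "coeff_x1 (formal_zcoeff B d w k s) * v ^ s \<in> Collect subtraction_free"
          if "s \<le> d k" for s
          using z[OF that] uv by (intro subfree.mult_in subfree.power_in) simp_all
      qed
    qed
    fix w k
    show "?R (formal_exch_poly trop_monomial B d w k u) (formal_exch_poly coeff_x1 B d w k v)"
      if "?R u v" for u v using that by (rule Q)
  qed
  then show ?thesis
    unfolding F_poly_def spec_x1_def[symmetric] by (blast intro: ratfun_eval_eq)
qed

text \<open>The polynomial \<open>Z_k\<close> at \<open>z = 0\<close>, typed so as to make sense in
  fields and in semifields. Being palindromic, it is the same at every vertex
  \<open>w\<close>.\<close>

definition z0_exch_poly :: "('n \<Rightarrow> nat) \<Rightarrow> 'n list \<Rightarrow> 'n \<Rightarrow> 'a::{comm_monoid_mult,plus} \<Rightarrow> 'a" where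
  "z0_exch_poly d w k u = 1 + u ^ d k"

abbreviation F_rec ::
    "('n::finite \<Rightarrow> 'n \<Rightarrow> int) \<Rightarrow> ('n \<Rightarrow> nat) \<Rightarrow> ('n \<Rightarrow> 'a::{comm_monoid_mult,inverse,plus}) \<Rightarrow>
      'n list \<Rightarrow> 'n \<Rightarrow> 'a" where
  "F_rec B d y \<equiv> cluster_rec B d (\<lambda>_. 1) y (z0_exch_poly d)"

lemma F_poly_z0_eq_F_rec:
  fixes B :: "'n::finite \<Rightarrow> 'n \<Rightarrow> int"
  assumes d: "\<And>k. d k \<ge> 1"
  shows "F_poly_z0 B d (rev w) j = F_rec B d ratvar w j"
proof -
  let ?R = "\<lambda>f a. evaluates spec_z0 f a \<and> a \<in> Collect subtraction_free"
  have "?R (F_poly B d (rev w) j) (F_rec B d ratvar w j)"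
    unfolding F_poly_eq_cluster_rec
  proof (rule cluster_rec_related[OF subfree.evaluates_relation])
    show "?R 1 1"
      by (simp add: evaluates_one subtraction_free.intros)
    show "?R (ratvar (Yvar i)) (ratvar i)" for i
      using evaluates_ratvar[of spec_z0 "Yvar i"] by (simp add: spec_z0_def subtraction_free.intros)
    fix w k
    show "?R (formal_exch_poly coeff_x1 B d w k u) (z0_exch_poly d w k v)" if uv: "?R u v" for u v
    proof
      show "z0_exch_poly d w k v \<in> Collect subtraction_free"
        unfolding z0_exch_poly_def using uv
        by (intro subfree.add_in subfree.power_in subfree.one_in) simp
      \<comment> \<open>The inner coefficients go to 0 and so leave the positive set; positivity can
        be claimed only for the whole sum.\<close>
      let ?z = "\<lambda>s. if s = 0 \<or> s = d k then 1 else 0"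
      have "evaluates spec_z0 (formal_exch_poly coeff_x1 B d w k u) (\<Sum>s\<le>d k. ?z s * v ^ s)"
        unfolding formal_exch_poly_def
      proof (rule evaluates_sum)
        fix s assume "s \<in> {..d k}"
        then have "s \<le> d k" by simp
        then have "evaluates spec_z0 (coeff_x1 (formal_zcoeff B d w k s)) (?z s)"
        proof (cases rule: formal_zcoeff_cases[of s d k B w])
          case 1
          then show ?thesis by (simp add: coeff_x1_one evaluates_one)
        next
          case (2 r)
          then show ?thesis
            using evaluates_ratvar[of spec_z0 "Zvar k r"] by (simp add: coeff_x1_var spec_z0_def)
        qed
        then show "evaluates spec_z0 (coeff_x1 (formal_zcoeff B d w k s) * u ^ s) (?z s * v ^ s)"
          using uv by (simp only: evaluates_mult evaluates_power)
      qed
      moreover have "(\<Sum>s\<le>d k. ?z s * v ^ s) = (\<Sum>s\<in>{0, d k}. ?z s * v ^ s)"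
        by (rule sum.mono_neutral_right) auto
      \<comment> \<open>\<open>d k \<ge> 1\<close> makes the indices 0 and \<open>d k\<close>
        distinct, so that both outer terms count.\<close>
      then have "(\<Sum>s\<le>d k. ?z s * v ^ s) = z0_exch_poly d w k v"
        using d[of k] by (simp add: z0_exch_poly_def)
      ultimately show "evaluates spec_z0 (formal_exch_poly coeff_x1 B d w k u) (z0_exch_poly d w k v)"
        by simp
    qed
  qed
  then show ?thesis
    unfolding F_poly_z0_def spec_z0_def[symmetric] by (blast intro: ratfun_eval_eq)
qed

text \<open>Running the recursion inside \<open>qsf\<close> certifies that the function is
  subtraction-free, so that \<open>Abs_qsf\<close> recovers the element it represents.\<close>

lemma Rep_F_rec: "Rep_qsf (F_rec B d qsf_var w j) = F_rec B d ratvar w j"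
proof -
  let ?R = "\<lambda>q f. f = Rep_qsf q"
  have "multiplicative_relation ?R"
    by unfold_locales (simp_all add: one_qsf.rep_eq times_qsf.rep_eq inverse_qsf.rep_eq)
  moreover have "Rep_qsf (u ^ m) = Rep_qsf u ^ m" for u :: "'a qsf" and m
    by (induction m) (simp_all add: one_qsf.rep_eq times_qsf.rep_eq)
  ultimately have "?R (F_rec B d qsf_var w j) (F_rec B d ratvar w j)"
    by (rule_tac cluster_rec_related)
      (simp_all add: z0_exch_poly_def one_qsf.rep_eq plus_qsf.rep_eq qsf_var.rep_eq)
  then show ?thesis by simp
qed

lemma F_poly_z0_semifield_eq_F_rec:
  assumes "\<And>k. d k \<ge> 1"
  shows "F_poly_z0_semifield B d (rev w) j y = F_rec B d y w j"
proof -
  have hom: "semifield_hom (qsf_eval y)" and var: "\<And>v. qsf_eval y (qsf_var v) = y v"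
    by (simp_all add: qsf_eval_hom_var)
  have "Abs_qsf (F_poly_z0 B d (rev w) j) = F_rec B d qsf_var w j"
    by (simp only: F_poly_z0_eq_F_rec[OF assms] Rep_F_rec[symmetric] Rep_qsf_inverse)
  moreover have "F_rec B d y w j = qsf_eval y (F_rec B d qsf_var w j)"
    by (rule cluster_rec_related[OF semifield_hom_relation[OF hom]])
      (simp_all add: z0_exch_poly_def var semifield_hom_one[OF hom] semifield_hom_add[OF hom]
        semifield_hom_power[OF hom])
  ultimately show ?thesis by (simp add: F_poly_z0_semifield_def)
qed

text \<open>Meant for \<open>yhat\<close> in the ambient field: since its entries lie in
  \<open>A\<close>, no value that has to be inverted on the way is 0.\<close>

lemma (in positive_set) ratfun_eval_F_poly_z0:
  assumes "\<And>k. d k \<ge> 1" "\<And>i. \<sigma> i \<in> A"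
  shows "ratfun_eval \<sigma> (F_poly_z0 B d (rev w) j) = F_rec B d \<sigma> w j" "F_rec B d \<sigma> w j \<in> A"
proof -
  let ?R = "\<lambda>f a. evaluates \<sigma> f a \<and> a \<in> A"
  have "?R (F_rec B d ratvar w j) (F_rec B d \<sigma> w j)"
    by (rule cluster_rec_related[OF evaluates_relation])
      (simp_all add: z0_exch_poly_def assms(2) evaluates_one evaluates_ratvar evaluates_add
        evaluates_power one_in add_in power_in)
  then show "ratfun_eval \<sigma> (F_poly_z0 B d (rev w) j) = F_rec B d \<sigma> w j" "F_rec B d \<sigma> w j \<in> A"
    by (simp_all only: F_poly_z0_eq_F_rec[OF assms(1)] ratfun_eval_eq)
qed

section \<open>\<open>g\<close>-vectors\<close>

lemma monomial_degree_zero: "monomial_degree B 0 = (\<lambda>_. 0)"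
  by (simp add: monomial_degree_def fun_eq_iff)

lemma monomial_degree_add:
  "monomial_degree B (m + n) = (\<lambda>i. monomial_degree B m i + monomial_degree B n i)"
  by (simp add: monomial_degree_def fun_eq_iff lookup_add distrib_right sum.distrib)

lemma homogeneous_mpoly_mult:
  assumes "homogeneous_mpoly B p a" "homogeneous_mpoly B q b"
  shows "homogeneous_mpoly B (p * q) (\<lambda>i. a i + b i)"
  unfolding homogeneous_mpoly_def
proof
  fix m assume "m \<in> Poly_Mapping.keys (p * q)"
  then obtain m1 m2 where "m = m1 + m2" "m1 \<in> Poly_Mapping.keys p" "m2 \<in> Poly_Mapping.keys q"
    using keys_mult[of p q] by blast
  then show "monomial_degree B m = (\<lambda>i. a i + b i)"
    using assms by (simp add: monomial_degree_add homogeneous_mpoly_def)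
qed

lemma homogeneous_mpoly_add:
  assumes "homogeneous_mpoly B p a" "homogeneous_mpoly B q a"
  shows "homogeneous_mpoly B (p + q) a"
  using assms Poly_Mapping.keys_add[of p q] unfolding homogeneous_mpoly_def by blast

lemma homogeneous_mpoly_unique:
  assumes "homogeneous_mpoly B p a" "homogeneous_mpoly B p b" "p \<noteq> 0"
  shows "a = b"
proof -
  obtain m where "m \<in> Poly_Mapping.keys p"
    using assms(3) by (metis keys_eq_empty ex_in_conv)
  then show ?thesis using assms(1,2) unfolding homogeneous_mpoly_def by metis
qed

lemma homogeneous_mpoly_one: "homogeneous_mpoly B 1 (\<lambda>_. 0)"
  by (simp add: homogeneous_mpoly_def monomial_degree_zero)

text \<open>Cross-multiplication yields one polynomial that is homogeneous of two degrees. It has to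
  be nonzero, as 0 is homogeneous of every degree.\<close>

lemma homogeneous_unique:
  assumes "homogeneous B f g" "homogeneous B f h" "f \<noteq> 0"
  shows "g = h"
proof -
  obtain p q a b where 1: "q \<noteq> 0" "f = Fract p q" "homogeneous_mpoly B p a"
    "homogeneous_mpoly B q b" "g = (\<lambda>i. a i - b i)"
    using assms(1) unfolding homogeneous_def by blast
  obtain p' q' a' b' where 2: "q' \<noteq> 0" "f = Fract p' q'" "homogeneous_mpoly B p' a'"
    "homogeneous_mpoly B q' b'" "h = (\<lambda>i. a' i - b' i)"
    using assms(2) unfolding homogeneous_def by blast
  have eq: "p * q' = p' * q" using 1 2 by (metis eq_fract(1))
  have "p \<noteq> 0" using 1 assms(3) by (auto simp: Zero_fract_def eq_fract)
  with 2 have "p * q' \<noteq> 0" by simp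
  moreover have "homogeneous_mpoly B (p * q') (\<lambda>i. a i + b' i)"
    by (rule homogeneous_mpoly_mult[OF 1(3) 2(4)])
  moreover have "homogeneous_mpoly B (p * q') (\<lambda>i. a' i + b i)"
    unfolding eq by (rule homogeneous_mpoly_mult[OF 2(3) 1(4)])
  ultimately have "(\<lambda>i. a i + b' i) = (\<lambda>i. a' i + b i)" by (blast dest: homogeneous_mpoly_unique)
  then show ?thesis unfolding 1(5) 2(5) fun_eq_iff by (metis add_diff_cancel diff_diff_eq2 diff_add_eq)
qed

lemma homogeneous_mult:
  assumes "homogeneous B f g" "homogeneous B f' g'"
  shows "homogeneous B (f * f') (\<lambda>i. g i + g' i)"
proof -
  obtain p q a b where 1: "q \<noteq> 0" "f = Fract p q" "homogeneous_mpoly B p a"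
    "homogeneous_mpoly B q b" "g = (\<lambda>i. a i - b i)"
    using assms(1) unfolding homogeneous_def by blast
  obtain p' q' a' b' where 2: "q' \<noteq> 0" "f' = Fract p' q'" "homogeneous_mpoly B p' a'"
    "homogeneous_mpoly B q' b'" "g' = (\<lambda>i. a' i - b' i)"
    using assms(2) unfolding homogeneous_def by blast
  show ?thesis
    unfolding homogeneous_def
    by (rule exI[of _ "p * p'"], rule exI[of _ "q * q'"], rule exI[of _ "\<lambda>i. a i + a' i"],
        rule exI[of _ "\<lambda>i. b i + b' i"])
      (use 1 2 in \<open>simp add: homogeneous_mpoly_mult fun_eq_iff\<close>)
qed

lemma homogeneous_add:
  assumes "homogeneous B f g" "homogeneous B f' g"
  shows "homogeneous B (f + f') g"
proof -
  obtain p q a b where 1: "q \<noteq> 0" "f = Fract p q" "homogeneous_mpoly B p a"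
    "homogeneous_mpoly B q b" "g = (\<lambda>i. a i - b i)"
    using assms(1) unfolding homogeneous_def by blast
  obtain p' q' a' b' where 2: "q' \<noteq> 0" "f' = Fract p' q'" "homogeneous_mpoly B p' a'"
    "homogeneous_mpoly B q' b'" "g = (\<lambda>i. a' i - b' i)"
    using assms(2) unfolding homogeneous_def by blast
  have "a' i + b i = a i + b' i" for i
    using 1(5) 2(5) by (simp add: fun_eq_iff) (smt (verit))
  then have "(\<lambda>i. a' i + b i) = (\<lambda>i. a i + b' i)" by blast
  then have "homogeneous_mpoly B (p * q' + p' * q) (\<lambda>i. a i + b' i)"
    using homogeneous_mpoly_add homogeneous_mpoly_mult 1(3,4) 2(3,4) by metis
  then show ?thesis
    unfolding homogeneous_def
    by (intro exI[of _ "p * q' + p' * q"] exI[of _ "q * q'"] exI[of _ "\<lambda>i. a i + b' i"]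
        exI[of _ "\<lambda>i. b i + b' i"])
      (use 1 2 in \<open>simp add: homogeneous_mpoly_mult\<close>)
qed

lemma homogeneous_inverse:
  assumes "homogeneous B f g" "f \<noteq> 0"
  shows "homogeneous B (inverse f) (\<lambda>i. - g i)"
proof -
  obtain p q a b where 1: "q \<noteq> 0" "f = Fract p q" "homogeneous_mpoly B p a"
    "homogeneous_mpoly B q b" "g = (\<lambda>i. a i - b i)"
    using assms(1) unfolding homogeneous_def by blast
  have "p \<noteq> 0" using 1 assms(2) by (auto simp: Zero_fract_def eq_fract)
  then show ?thesis
    unfolding homogeneous_def
    by (intro exI[of _ q] exI[of _ p] exI[of _ b] exI[of _ a]) (use 1 in simp)
qed

lemma homogeneous_one: "homogeneous B 1 (\<lambda>_. 0)"
  unfolding homogeneous_def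
  by (intro exI[of _ 1] exI[of _ "\<lambda>_. 0"]) (simp add: One_fract_def homogeneous_mpoly_one)

lemma homogeneous_ratvar:
  "homogeneous B (ratvar v) (monomial_degree B (Poly_Mapping.single (Indet v) 1))"
  unfolding homogeneous_def ratvar_def
  by (intro exI[of _ "Poly_Mapping.single (Poly_Mapping.single (Indet v) 1) 1"] exI[of _ 1]
      exI[of _ "monomial_degree B (Poly_Mapping.single (Indet v) 1)"] exI[of _ "\<lambda>_. 0"])
    (simp add: homogeneous_mpoly_one homogeneous_mpoly_def[where a = "monomial_degree _ _"])

lemma degree_Xvar:
  "monomial_degree B (Poly_Mapping.single (Indet (Xvar j)) 1) = (\<lambda>i. if j = i then 1 else 0)"
  by (auto simp: monomial_degree_def fun_eq_iff lookup_single when_def)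

lemma degree_Yvar:
  "monomial_degree B (Poly_Mapping.single (Indet (Cvar (Yvar j))) 1) = (\<lambda>i. - B i j)"
proof -
  have "(\<Sum>k\<in>UNIV. int (1 when j = k) * B i k) = (\<Sum>k\<in>UNIV. if k = j then B i k else 0)" for i
    by (rule sum.cong) (auto simp: when_def)
  then show ?thesis
    by (simp add: monomial_degree_def fun_eq_iff lookup_single)
qed

lemma degree_Zvar:
  "monomial_degree B (Poly_Mapping.single (Indet (Cvar (Zvar j s))) 1) = (\<lambda>_. 0)"
  by (auto simp: monomial_degree_def fun_eq_iff lookup_single when_def)

lemma homogeneous_power_degree_zero:
  "homogeneous B f (\<lambda>_. 0) \<Longrightarrow> homogeneous B (f ^ m) (\<lambda>_. 0)"
proof (induction m)
  case 0
  show ?case by (simp add: homogeneous_one)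
next
  case (Suc m)
  then show ?case using homogeneous_mult[of B f "\<lambda>_. 0" "f ^ m" "\<lambda>_. 0"] by simp
qed

lemma homogeneous_sum_atMost:
  "(\<And>s. s \<le> m \<Longrightarrow> homogeneous B (f s) g) \<Longrightarrow> homogeneous B (\<Sum>s\<le>(m::nat). f s) g"
  by (induction m) (auto intro: homogeneous_add)

text \<open>The degree of \<open>yhat\<close>, read multiplicatively: it is trivial initially by the
  choice of \<open>y\<close>, and mutating coefficients equal to 1 with the exchange polynomial 1
  gives 1 again.\<close>

lemma coeff_rec_one:
  fixes x y :: "'n::finite \<Rightarrow> 'p::semifield"
  assumes "skew_symmetrizable B" "\<And>j. y j = inverse (\<Prod>i\<in>UNIV. x i powi B i j)"
  shows "coeff_rec B d y (cluster_rec B d x y (\<lambda>_ _ _. 1) w) w j = 1"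
proof (induction w arbitrary: j)
  case Nil
  show ?case by (simp add: coeff_rec_Nil assms(2) semifield_left_inverse)
next
  case (Cons k w)
  then show ?case
    by (simp only: coeff_rec_mutation[OF assms(1)]) (simp add: semifield_inverse_one)
qed

text \<open>The degree of \<open>y_j\<close> in the \<open>g\<close>-grading, written as a monomial
  so that adding degrees becomes multiplication.\<close>

definition trop_y :: "('n::finite \<Rightarrow> 'n \<Rightarrow> int) \<Rightarrow> 'n \<Rightarrow> 'n trop" where
  "trop_y B j = inverse (\<Prod>i\<in>UNIV. trop_var i powi B i j)"

lemma texp_trop_y: "texp (trop_y B j) i = - B i j"
proof -
  have "(\<Sum>k\<in>UNIV. texp (trop_var k powi B k j) i) = (\<Sum>k\<in>UNIV. if k = i then B i j else 0)"
    by (rule sum.cong) (auto simp: texp_trop_var)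
  then show ?thesis by (simp add: trop_y_def)
qed

abbreviation g_rec :: "('n::finite \<Rightarrow> 'n \<Rightarrow> int) \<Rightarrow> ('n \<Rightarrow> nat) \<Rightarrow> 'n list \<Rightarrow> 'n \<Rightarrow> 'n trop" where
  "g_rec B d \<equiv> cluster_rec B d trop_var (trop_y B) (\<lambda>_ _ _. 1)"

lemma g_vec_eq_g_rec:
  fixes B :: "'n::finite \<Rightarrow> 'n \<Rightarrow> int"
  assumes skew: "skew_symmetrizable B"
  shows "g_vec B d (rev w) i j = texp (g_rec B d w j) i"
proof -
  \<comment> \<open>Subtraction-freeness is carried along because inverses and the uniqueness of the
    degree require nonzero functions.\<close>
  let ?R = "\<lambda>f a. f \<in> Collect subtraction_free \<and> homogeneous B f (texp a)"
  have R: "multiplicative_relation ?R"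
  proof
    show "?R 1 1" using homogeneous_one[of B] by (simp add: subtraction_free.intros texp_one[abs_def])
  next
    fix a a' and b b' :: "'n trop" assume "?R a b" "?R a' b'"
    then show "?R (a * a') (b * b')"
      using homogeneous_mult[of B a "texp b" a' "texp b'"]
      by (simp add: subtraction_free.intros texp_mult[abs_def])
  next
    fix a and b :: "'n trop" assume "?R a b"
    then show "?R (inverse a) (inverse b)"
      using homogeneous_inverse[of B a "texp b"]
      by (simp add: subtraction_free_inverse subtraction_free_nonzero texp_inverse[abs_def])
  qed
  have "?R (X_fun B d (rev w) j) (g_rec B d w j)"
    unfolding X_fun_eq_cluster_rec
  proof (rule cluster_rec_related[OF R])
    show "?R (ratvar (Xvar i)) (trop_var i)" for i
      using homogeneous_ratvar[of B "Xvar i"]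
      by (simp add: subtraction_free.intros degree_Xvar[simplified] texp_trop_var[abs_def])
    show "?R (ratvar (Cvar (Yvar i))) (trop_y B i)" for i
      using homogeneous_ratvar[of B "Cvar (Yvar i)"]
      by (simp add: subtraction_free.intros degree_Yvar[simplified] texp_trop_y[abs_def])
  next
    fix w k
    have z: "subtraction_free (trop_monomial (formal_zcoeff B d w k s))"
      "homogeneous B (trop_monomial (formal_zcoeff B d w k s)) (\<lambda>_. 0)" if "s \<le> d k" for s
      using that homogeneous_ratvar[of B "Cvar (Zvar k _)", unfolded degree_Zvar]
      by (cases rule: formal_zcoeff_cases[of s d k B w];
          simp add: homogeneous_one subtraction_free.intros)+
    have Q: "formal_exch_poly trop_monomial B d w k u \<in> Collect subtraction_free"
      "homogeneous B (formal_exch_poly trop_monomial B d w k u) (\<lambda>_. 0)"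
      if u: "subtraction_free u" "homogeneous B u (\<lambda>_. 0)" for u
    proof -
      show "formal_exch_poly trop_monomial B d w k u \<in> Collect subtraction_free"
        unfolding formal_exch_poly_def
        by (intro subfree.sum_in subfree.mult_in subfree.power_in) (use z u in simp_all)
      show "homogeneous B (formal_exch_poly trop_monomial B d w k u) (\<lambda>_. 0)"
        unfolding formal_exch_poly_def
        using homogeneous_mult[OF z(2) homogeneous_power_degree_zero[OF u(2)]]
        by (intro homogeneous_sum_atMost) simp
    qed
    \<comment> \<open>The argument of the exchange polynomial is thus of degree 0, so all terms have
      degree 0 and their sum is homogeneous.\<close>
    have "coeff_rec B d (trop_y B) (g_rec B d w) w k = 1"
      by (rule coeff_rec_one[OF skew]) (simp add: trop_y_def)
    then show "?R (formal_exch_poly trop_monomial B d w k u) 1"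
      if "?R u (coeff_rec B d (trop_y B) (g_rec B d w) w k)" for u
      using that Q[of u] by (simp add: texp_one[abs_def])
  qed
  then have "homogeneous B (X_fun B d (rev w) j) (texp (g_rec B d w j))" "X_fun B d (rev w) j \<noteq> 0"
    by (simp_all add: subtraction_free_nonzero)
  then have "(THE g. homogeneous B (X_fun B d (rev w) j) g) = texp (g_rec B d w j)"
    by (blast intro: the_equality homogeneous_unique)
  then show ?thesis by (simp add: g_vec_def)
qed

section \<open>Positive elements of the ambient field\<close>

text \<open>Used at two levels: for the group ring over the positive integers, then for polynomials
  in the cluster over the fraction field.\<close>

definition positive_polys :: "'c set \<Rightarrow> ('a \<Rightarrow>\<^sub>0 'c::zero) set" where
  "positive_polys K = {p. p \<noteq> 0 \<and> coeffs_in (insert 0 K) p}"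

lemma (in positive_cone) single_in_positive_polys:
  "c \<in> K \<Longrightarrow> Poly_Mapping.single m c \<in> positive_polys K"
  using zero_notin nonneg.coeffs_in_single[of c m]
  by (auto simp: positive_polys_def) (metis lookup_single_eq lookup_zero)

text \<open>Products are nonzero because the ring is a domain; a sum is nonzero because a
  coefficient of \<open>p\<close> in \<open>K\<close> stays in \<open>K\<close> after adding an
  element of \<open>insert 0 K\<close>.\<close>

lemma (in positive_cone) positive_cone_positive_polys:
  "positive_cone (positive_polys K :: ('a::{ordered_cancel_comm_monoid_add,linorder} \<Rightarrow>\<^sub>0 'c) set)"
proof
  show "1 \<in> positive_polys K"
    using single_in_positive_polys[OF one_in, of 0] by simp
  show "0 \<notin> positive_polys K" by (simp add: positive_polys_def)
  fix p q :: "'a \<Rightarrow>\<^sub>0 'c" assume pq: "p \<in> positive_polys K" "q \<in> positive_polys K"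
  then show "p * q \<in> positive_polys K"
    by (simp add: positive_polys_def nonneg.coeffs_in_mult)
  obtain m where "Poly_Mapping.lookup p m \<noteq> 0"
    using pq(1) unfolding positive_polys_def by (auto simp: poly_mapping_eq_iff fun_eq_iff)
  then have "Poly_Mapping.lookup p m \<in> K" "Poly_Mapping.lookup q m \<in> insert 0 K"
    using pq unfolding positive_polys_def coeffs_in_def by blast+
  then have "Poly_Mapping.lookup (p + q) m \<in> K"
    by (auto simp: lookup_add intro: add_in)
  then have "p + q \<noteq> 0" using zero_notin by auto
  then show "p + q \<in> positive_polys K"
    using pq by (simp add: positive_polys_def nonneg.coeffs_in_add)
qed

lemma (in positive_cone) positive_set_quotients:
  fixes E :: "'c \<Rightarrow> 'k::field"
  assumes "\<And>a b. a \<in> K \<Longrightarrow> b \<in> K \<Longrightarrow> E (a + b) = E a + E b"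
    and "\<And>a b. a \<in> K \<Longrightarrow> b \<in> K \<Longrightarrow> E (a * b) = E a * E b"
    and nz: "\<And>a. a \<in> K \<Longrightarrow> E a \<noteq> 0"
  shows "positive_set {E a / E b | a b. a \<in> K \<and> b \<in> K}" (is "positive_set ?Q")
proof
  show "1 \<in> ?Q" using one_in nz[OF one_in] by force
  show "0 \<notin> ?Q" using nz by auto
  fix u v assume "u \<in> ?Q" "v \<in> ?Q"
  then obtain a b a' b' where u: "u = E a / E b" "v = E a' / E b'"
    and in_K: "a \<in> K" "b \<in> K" "a' \<in> K" "b' \<in> K"
    by blast
  have "u + v = E (a * b' + a' * b) / E (b * b')"
    using in_K by (simp add: u assms mult_in add_frac_eq)
  then show "u + v \<in> ?Q" using in_K by (blast intro: add_in mult_in)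
  have "u * v = E (a * a') / E (b * b')"
    using in_K by (simp add: u assms)
  then show "u * v \<in> ?Q" using in_K by (blast intro: mult_in)
next
  fix u assume "u \<in> ?Q"
  then show "inverse u \<in> ?Q" by force
qed

definition positive_group_field :: "'p::semifield group_field set" where
  "positive_group_field =
     {Fract a 1 / Fract b 1 | a b. a \<in> positive_polys {0<..} \<and> b \<in> positive_polys {0<..}}"

interpretation positive_int: positive_cone "{0<..} :: int set"
  by unfold_locales auto

interpretation positive_group_field:
  positive_set "positive_group_field :: 'p::semifield group_field set"
proof -
  interpret positive_cone "positive_polys {0<..} :: 'p group_ring set"
    by (rule positive_int.positive_cone_positive_polys)
  have "Fract a 1 \<noteq> 0" if "a \<in> positive_polys {0<..}" for a :: "'p group_ring"
    using that by (auto simp: Zero_fract_def eq_fract positive_polys_def)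
  then show "positive_set (positive_group_field :: 'p group_field set)"
    unfolding positive_group_field_def by (intro positive_set_quotients) simp_all
qed

lemma of_semifield_positive: "of_semifield p \<in> positive_group_field"
  unfolding positive_group_field_def mem_Collect_eq
  by (rule exI[of _ "Poly_Mapping.single (Additive p) 1"], rule exI[of _ 1])
    (use positive_int.single_in_positive_polys[of 1 "Additive p"]
      positive_int.single_in_positive_polys[of 1 "0 :: 'a additive"] in
      \<open>simp add: of_semifield_def One_fract_def[symmetric]\<close>)

text \<open>Algebraic independence means that evaluation at the cluster kills no nonzero polynomial;
  polynomials with positive coefficients thus have nonzero values, and the quotients of these form
  \<open>A\<close>.\<close>

lemma positive_set_ambient:
  fixes \<phi> :: "'p::semifield group_field \<Rightarrow> 'f::field" and x :: "'n \<Rightarrow> 'f"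
  assumes \<phi>: "field_hom \<phi>" and ind: "algebraically_independent \<phi> x"
  obtains A where "positive_set A" "\<And>i. x i \<in> A" "\<And>p. \<phi> (of_semifield p) \<in> A"
proof -
  have \<phi>_add: "\<phi> (a + b) = \<phi> a + \<phi> b" and \<phi>_mult: "\<phi> (a * b) = \<phi> a * \<phi> b"
    and \<phi>_one: "\<phi> 1 = 1" for a b
    using \<phi> unfolding field_hom_def by blast+
  have \<phi>_zero: "\<phi> 0 = 0" by (metis \<phi>_add add_0 add_cancel_right_right)
  interpret E: coeff_hom UNIV \<phi>
    by unfold_locales (auto simp: \<phi>_add \<phi>_mult \<phi>_zero)
  let ?P = "positive_polys positive_group_field :: ('n, 'p group_field) mpoly set"
  interpret P: positive_cone ?P
    by (rule positive_group_field.positive_cone_positive_polys)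
  let ?E = "mpoly_eval \<phi> x"
  define A where "A = {?E p / ?E q | p q. p \<in> ?P \<and> q \<in> ?P}"
  have one: "1 \<in> ?P" "?E 1 = 1"
    using P.one_in E.mpoly_eval_single[of x 0 1] by (simp_all add: \<phi>_one)
  have nz: "?E p \<noteq> 0" if "p \<in> ?P" for p
    using that ind unfolding algebraically_independent_def positive_polys_def by blast
  have single: "\<phi> c * mono_eval x m \<in> A" if "c \<in> positive_group_field" for c m
    unfolding A_def mem_Collect_eq
    by (rule exI[of _ "Poly_Mapping.single m c"], rule exI[of _ 1])
      (simp add: E.mpoly_eval_single one positive_group_field.single_in_positive_polys[OF that])
  show ?thesis
  proof
    show "positive_set A"
      unfolding A_def
      by (rule P.positive_set_quotients) (simp_all add: E.mpoly_eval_add E.mpoly_eval_mult nz)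
    show "x i \<in> A" for i
      using single[OF positive_group_field.one_in, of "Poly_Mapping.single (Indet i) (Suc 0)"]
      by (simp add: \<phi>_one)
    show "\<phi> (of_semifield p) \<in> A" for p
      using single[OF of_semifield_positive, of p 0] by simp
  qed
qed

lemma of_semifield_mult: "of_semifield (a * b) = of_semifield a * of_semifield b"
  by (simp add: of_semifield_def mult_single plus_additive_def)

lemma of_semifield_one: "of_semifield 1 = 1"
  by (simp add: of_semifield_def zero_additive_def[symmetric] One_fract_def)

section \<open>The right companion\<close>

lemma pos_part_mult_int: "pos_part (a * int m) = pos_part a * int m"
  by (cases "a \<ge> 0") (auto simp: pos_part_def max_def mult_le_0_iff zero_le_mult_iff)

lemma exch_poly_semifield_ordinary:
  assumes "zdeg S = (\<lambda>_. 1)" "zcoeff S = (\<lambda>_ _. 1)"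
  shows "exch_poly_semifield S k y = 1 + y"
  by (simp add: exch_poly_semifield_def assms)

lemma exch_poly_field_ordinary:
  assumes "zdeg S = (\<lambda>_. 1)" "zcoeff S = (\<lambda>_ _. 1)" "\<iota> 1 = 1"
  shows "exch_poly_field \<iota> S k u = 1 + u"
  by (simp add: exch_poly_field_def assms)

text \<open>Isolates what the comparison rests on. The map \<open>\<iota>\<close> is multiplicative
  but not additive, so \<open>\<iota> (1 + y)\<close> and \<open>1 + \<iota> y\<close> must be kept
  apart in the exchange relation.\<close>

locale companion =
  fixes \<iota> :: "'p::semifield \<Rightarrow> 'f::field" and S :: "('n::finite, 'p, 'f) seed" and A :: "'f set"
  assumes iota_one: "\<iota> 1 = 1"
    and iota_mult: "\<iota> (a * b) = \<iota> a * \<iota> b"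
    and positive: "positive_set A"
    and iota_in: "\<iota> p \<in> A"
    and cluster_in: "cluster S i \<in> A"
    and skew: "skew_symmetrizable (exch S)"
    and zdeg_pos: "zdeg S i \<ge> 1"
begin

interpretation A: positive_set A
  by (rule positive)

abbreviation "B \<equiv> exch S"
abbreviation "d \<equiv> zdeg S"
abbreviation "FP w \<equiv> F_rec B d (coeff S) w"
abbreviation "FF w \<equiv> F_rec B d (yhat \<iota> S) w"
abbreviation "yP w \<equiv> coeff_rec B d (coeff S) (FP w) w"
abbreviation "yF w \<equiv> coeff_rec B d (yhat \<iota> S) (FF w) w"

lemma iota_nonzero: "\<iota> p \<noteq> 0"
  using iota_in[of p] A.zero_notin by auto

lemma cluster_nonzero: "cluster S i \<noteq> 0"
  using cluster_in[of i] A.zero_notin by auto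

lemma iota_inverse: "\<iota> (inverse p) = inverse (\<iota> p)"
  using iota_mult[of p "inverse p"] by (simp add: semifield_right_inverse iota_one inverse_unique)

lemma yhat_in: "yhat \<iota> S k \<in> A"
  unfolding yhat_def by (intro A.mult_in A.prod_in A.powi_in iota_in cluster_in)

definition xmon :: "'n trop \<Rightarrow> 'f" where
  "xmon a = (\<Prod>i\<in>UNIV. cluster S i powi texp a i)"

text \<open>Being multiplicative, \<open>assemble\<close> turns the recursions for the \<open>g\<close>-vectors, for
  \<open>F(yhat)\<close> and for \<open>F(y)\<close> into one exchange relation; the tropical parts of the three
  coefficient systems cancel.\<close>

definition assemble :: "'n trop \<Rightarrow> 'f \<Rightarrow> 'p \<Rightarrow> 'f" where
  "assemble a u p = xmon a * u * inverse (\<iota> p)"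

lemma assemble_mult: "assemble (a * a') (u * u') (p * p') = assemble a u p * assemble a' u' p'"
  by (simp add: assemble_def xmon_def power_int_add cluster_nonzero prod.distrib iota_mult)

lemma assemble_one: "assemble 1 1 1 = 1"
  by (simp add: assemble_def xmon_def iota_one)

lemma assemble_inverse: "assemble (inverse a) (inverse u) (inverse p) = inverse (assemble a u p)"
  by (simp add: assemble_def xmon_def power_int_minus prod_inversef[symmetric] iota_inverse o_def)

lemma assemble_power: "assemble (a ^ m) (u ^ m) (p ^ m) = assemble a u p ^ m"
  by (induction m) (simp_all add: assemble_one assemble_mult)

lemma assemble_powi: "assemble (a powi n) (u powi n) (p powi n) = assemble a u p powi n"
  by (simp add: power_int_def assemble_power[symmetric] assemble_inverse[symmetric])

lemma assemble_prod:
  "assemble (\<Prod>i\<in>I. a i) (\<Prod>i\<in>I. u i) (\<Prod>i\<in>I. p i) = (\<Prod>i\<in>I. assemble (a i) (u i) (p i))"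
  by (induction I rule: infinite_finite_induct) (simp_all add: assemble_one assemble_mult)

text \<open>The source of all cancellation: the degree of \<open>y_j\<close> contributes the inverse
  of the monomial by which \<open>yhat\<close> differs from \<open>y\<close>.\<close>

lemma assemble_initial: "assemble (trop_y B j) (yhat \<iota> S j) (coeff S j) = 1"
proof -
  define m where "m = (\<Prod>i\<in>UNIV. cluster S i powi B i j)"
  have "xmon (trop_y B j) = inverse m"
    by (simp add: m_def xmon_def texp_trop_y power_int_minus prod_inversef[symmetric] o_def)
  moreover have "m \<noteq> 0"
    by (simp add: m_def cluster_nonzero)
  ultimately show ?thesis
    by (simp add: assemble_def yhat_def m_def[symmetric] field_simps iota_nonzero)
qed

definition xbar :: "'n list \<Rightarrow> 'n \<Rightarrow> 'f" where
  "xbar w j = assemble (g_rec B d w j) (FF w j) (FP w j)"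

lemma cluster_z0_eq: "cluster_z0 \<iota> S (rev w) j = xbar w j"
  unfolding cluster_z0_def xbar_def assemble_def xmon_def
  by (simp only: g_vec_eq_g_rec[OF skew] A.ratfun_eval_F_poly_z0(1)[OF zdeg_pos yhat_in]
      F_poly_z0_semifield_eq_F_rec[OF zdeg_pos] divide_inverse)

lemma coeff_z0_eq: "coeff_z0 \<iota> S (rev w) j = yP w j"
  unfolding coeff_z0_def coeff_rec_def
  by (simp only: c_vec_eq_c_mat F_poly_z0_semifield_eq_F_rec[OF zdeg_pos] exch_seed_at)

text \<open>\<open>assemble\<close> is applied to the three coefficient systems: the initial parts
  cancel, and the tropical system is 1 because \<open>yhat\<close> has degree 0. What remains is the
  formula defining \<open>yhat\<close> at the vertex, for the specialized seed.\<close>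

lemma yF_eq: "yF w k = \<iota> (yP w k) * (\<Prod>i\<in>UNIV. xbar w i powi exch_mat B d w i k)"
proof -
  let ?g = "coeff_rec B d (trop_y B) (g_rec B d w) w k"
  have "assemble ?g (yF w k) (yP w k)
      = (\<Prod>i\<in>UNIV. assemble (trop_y B i) (yhat \<iota> S i) (coeff S i) powi c_mat B d w i k)
        * (\<Prod>i\<in>UNIV. xbar w i powi exch_mat B d w i k)"
    by (simp only: coeff_rec_def assemble_mult assemble_prod assemble_powi xbar_def)
  also have "\<dots> = (\<Prod>i\<in>UNIV. xbar w i powi exch_mat B d w i k)"
    by (simp add: assemble_initial)
  also have "?g = 1"
    by (rule coeff_rec_one[OF skew]) (simp add: trop_y_def)
  finally show ?thesis
    by (simp add: assemble_def xmon_def field_simps iota_nonzero)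
qed

text \<open>Once \<open>assemble_initial\<close> has removed the tropical monomials, only the
  quotient of the two exchange polynomials is left; the \<open>g\<close>-vector component
  contributes 1.\<close>

lemma xbar_Cons:
  "xbar (k # w) = (xbar w)(k := inverse (xbar w k)
     * (\<Prod>i\<in>UNIV. xbar w i powi pos_part (- exch_mat B d w i k)) ^ d k
     * ((1 + yF w k ^ d k) * inverse (\<iota> (1 + yP w k ^ d k))))"
proof -
  have "xbar (k # w) k = inverse (xbar w k)
     * (\<Prod>i\<in>UNIV. xbar w i powi pos_part (- exch_mat B d w i k)) ^ d k
     * (\<Prod>i\<in>UNIV. assemble (trop_y B i) (yhat \<iota> S i) (coeff S i)
         powi pos_part (- c_mat B d w i k)) ^ d k
     * assemble 1 (1 + yF w k ^ d k) (1 + yP w k ^ d k)"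
    unfolding xbar_def cluster_rec.simps fun_upd_same z0_exch_poly_def
    by (simp only: assemble_mult assemble_prod assemble_powi assemble_power assemble_inverse)
  then have "xbar (k # w) k = inverse (xbar w k)
     * (\<Prod>i\<in>UNIV. xbar w i powi pos_part (- exch_mat B d w i k)) ^ d k
     * ((1 + yF w k ^ d k) * inverse (\<iota> (1 + yP w k ^ d k)))"
    by (simp add: assemble_initial) (simp add: assemble_def xmon_def)
  then show ?thesis by (auto simp: xbar_def)
qed

text \<open>Cluster and coefficients share one induction, since the exchange relation uses both.
  Scaling columns by \<open>d\<close> commutes with mutation because
  \<open>[b * d]_+ = [b]_+ * d\<close> and column \<open>k\<close> supplies the factor
  \<open>d k\<close> of the generalized rule.\<close>

lemma right_companion_seed_at:
  fixes w defines "T \<equiv> seed_at \<iota> (right_companion S) (rev w)"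
  shows "zdeg T = (\<lambda>_. 1) \<and> zcoeff T = (\<lambda>_ _. 1) \<and>
    exch T = (\<lambda>i j. exch_mat B d w i j * int (d j)) \<and>
    coeff T = (\<lambda>j. yP w j ^ d j) \<and> cluster T = xbar w"
  unfolding T_def
proof (induction w)
  case Nil
  have "yP [] j = coeff S j" for j by (simp add: coeff_rec_Nil)
  moreover have "xbar [] j = cluster S j" for j
  proof -
    have "(\<Prod>i\<in>UNIV. cluster S i powi (if j = i then 1 else 0))
        = (\<Prod>i\<in>UNIV. if i = j then cluster S i else 1)"
      by (rule prod.cong) auto
    then show ?thesis
      by (simp add: xbar_def assemble_def xmon_def iota_one texp_trop_var)
  qed
  ultimately show ?case
    by (simp add: right_companion_def ordinary_seed_def fun_eq_iff)
next
  case (Cons k w)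
  define T where "T = seed_at \<iota> (right_companion S) (rev w)"
  have T: "zdeg T = (\<lambda>_. 1)" "zcoeff T = (\<lambda>_ _. 1)"
    "exch T = (\<lambda>i j. exch_mat B d w i j * int (d j))"
    "coeff T = (\<lambda>j. yP w j ^ d j)" "cluster T = xbar w"
    using Cons.IH unfolding T_def by blast+
  have pos: "pos_part (- (a * int m)) = pos_part (- a) * int m" for a m
    using pos_part_mult_int[of "- a" m] by simp
  have seed: "seed_at \<iota> (right_companion S) (rev (k # w)) = mutate \<iota> k T"
    by (simp add: T_def)
  have ex: "exch_poly_semifield T k (coeff T k) = 1 + yP w k ^ d k"
    using T by (simp add: exch_poly_semifield_ordinary)
  have exch: "exch (mutate \<iota> k T) = (\<lambda>i j. exch_mat B d (k # w) i j * int (d j))"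
    by (auto simp: T pos_part_mult_int pos intro!: ext) (simp add: algebra_simps)
  have coeff: "coeff (mutate \<iota> k T) j = yP (k # w) j ^ d j" for j
  proof (cases "j = k")
    case True
    then show ?thesis
      unfolding coeff_mutate coeff_mutate_coeff T coeff_rec_mutation[OF skew]
      by (simp add: semifield_inverse_power)
  next
    case False
    \<comment> \<open>Raising the generalized rule to the power \<open>d j\<close> produces the
      factor \<open>d j\<close> in both exponents.\<close>
    have "coeff (mutate \<iota> k T) j = yP w j ^ d j
        * (yP w k ^ d k) powi (pos_part (exch_mat B d w k j) * int (d j))
        * (1 + yP w k ^ d k) powi (- exch_mat B d w k j * int (d j))"
      using False by (simp add: coeff_mutate_coeff ex) (simp add: T pos_part_mult_int)
    also have "\<dots> = yP (k # w) j ^ d j"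
      using False
      by (simp only: coeff_rec_mutation[OF skew] if_False power_mult_distrib z0_exch_poly_def
          semifield_powi_mult semifield_power_eq_powi[of "_ powi _"])
    finally show ?thesis .
  qed
  \<comment> \<open>Column \<open>k\<close> of the companion matrix carries the factor
    \<open>d k\<close>, and so does the exponent of its coefficient; hence \<open>yF_eq\<close> is
    raised to that power.\<close>
  have yh: "yhat \<iota> T k = yF w k ^ d k"
  proof -
    have "\<iota> (p ^ m) = \<iota> p ^ m" for p m
      by (induction m) (simp_all add: iota_one iota_mult)
    then show ?thesis
      by (simp add: yhat_def T yF_eq power_mult_distrib prod_power_distrib power_int_mult)
  qed
  have pf: "exch_poly_field \<iota> T k u = 1 + u" for u
    by (rule exch_poly_field_ordinary) (simp_all add: T iota_one)
  have M: "(\<Prod>i\<in>UNIV. xbar w i powi pos_part (- exch T i k)) ^ zdeg T k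
      = (\<Prod>i\<in>UNIV. xbar w i powi pos_part (- exch_mat B d w i k)) ^ d k"
    by (simp add: T pos prod_power_distrib power_int_mult)
  have cl: "cluster (mutate \<iota> k T) = xbar (k # w)"
    unfolding cluster_mutate ex yh xbar_Cons pf M T(5)
    by (simp only: divide_inverse ac_simps)
  have z: "zdeg (mutate \<iota> k T) = (\<lambda>_. 1)" "zcoeff (mutate \<iota> k T) = (\<lambda>_ _. 1)"
    by (simp_all add: T zcoeff_mutate_coeff fun_eq_iff)
  have coeff': "coeff (mutate \<iota> k T) = (\<lambda>j. yP (k # w) j ^ d j)"
    by (rule ext) (rule coeff)
  show ?case
    unfolding seed by (intro conjI z exch coeff' cl)
qed

end

theorem theorem1p2:
  fixes \<phi> :: "'p::semifield group_field \<Rightarrow> 'f::field"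
    and S :: "('n::finite, 'p, 'f) seed"
    and t :: "'n list"
    and i j :: 'n
  assumes "generalized_seed \<phi> S"
    and "t \<in> tree_vertices"
  shows "cluster_z0 (\<phi> \<circ> of_semifield) S t i
           = cluster (seed_at (\<phi> \<circ> of_semifield) (right_companion S) t) i
       \<and> coeff_z0 (\<phi> \<circ> of_semifield) S t j ^ zdeg S j
           = coeff (seed_at (\<phi> \<circ> of_semifield) (right_companion S) t) j"
proof -
  have \<phi>: "field_hom \<phi>" and ind: "algebraically_independent \<phi> (cluster S)"
    and skew: "skew_symmetrizable (exch S)" and deg: "\<And>i. zdeg S i \<ge> 1"
    using assms(1) unfolding generalized_seed_def by blast+
  obtain A where A: "positive_set A" "\<And>i. cluster S i \<in> A" "\<And>p. \<phi> (of_semifield p) \<in> A"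
    using positive_set_ambient[OF \<phi> ind] by blast
  interpret companion "\<phi> \<circ> of_semifield" S A
    using A skew deg \<phi>
    by (intro companion.intro) (simp_all add: of_semifield_one of_semifield_mult field_hom_def)
  \<comment> \<open>The recursions read a path from its end, hence \<open>rev t\<close>.\<close>
  show ?thesis
    using right_companion_seed_at[of "rev t"] cluster_z0_eq[of "rev t" i] coeff_z0_eq[of "rev t" j]
    by simp
qed

end
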